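(* Let $P,Q$ be orthogonal projections in a Hilbert space $\mathcal{H}$, let $P',Q'$ be their reductions to $\mathcal{H}'=N(P+Q-1)^\perp$, and let $X_{P',Q'}$ be the exponent of the minimal geodesic joining $P'$ and $Q'$, with matrix in terms of $P'$ (i.e. with respect to $\mathcal{H}'=R(P')\oplus N(P')$) $$X_{P',Q'}=\begin{pmatrix}0&Z\\Z^*&0\end{pmatrix},\qquad Z:N(P')\to R(P').$$ Then $PQ$ is S-decomposable if and only if $Z$ is S-decomposable, if and only if $X_{P',Q'}$ is diagonalizable.
   Context: $N(\cdot)$ and $R(\cdot)$ denote nullspace and range. The subspace $\mathcal{H}'=N(P+Q-1)^\perp$ reduces $P$ and $Q$, and $P'=P|_{\mathcal{H}'}$, $Q'=Q|_{\mathcal{H}'}$ are regarded as operators on $\mathcal{H}'$. Since $N(P'+Q'-1)=\{0\}$, there is a unique operator $X=X_{P',Q'}$ on $\mathcal{H}'$ with $X^*=X$, $\|X\|\le\pi/2$, $X$ $P'$-codiagonal (i.e. $P'XP'=(1-P')X(1-P')=0$) and $e^{iX}P'e^{-iX}=Q'$. A bounded operator $T$ between Hilbert spaces is called S-decomposable if it has a singular value (Schmidt) decomposition $T=\sum_n s_n\langle\,\cdot\,,\xi_n\rangle\psi_n$ (strong convergence), where $\{\xi_n\}$ and $\{\psi_n\}$ are orthonormal systems (in the domain and codomain, respectively) indexed by the same index set (possibly finite or empty; countable in the separable case) and $s_n>0$ for all $n$; equivalently, $T^*T$ is diagonalizable. A self-adjoint operator is diagonalizable if there is an orthonormal basis of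 the space consisting of its eigenvectors. *)

theory Defs
  imports "HOL-Analysis.Analysis"
begin

text \<open>
  Complex Hilbert spaces, as real inner product spaces (so that the library's norm, topology
  and infinite sums apply) equipped with a complex scalar multiplication and a sesquilinear
  inner product whose real part is the given real one.  The complex inner product is linear in
  its \<^emph>\<open>first\<close> argument.
\<close>

class complex_hilbert = real_inner + complete_space +
  fixes scaleC :: "complex \<Rightarrow> 'a \<Rightarrow> 'a"  (infixr "*\<^sub>C" 75)
    and cinner :: "'a \<Rightarrow> 'a \<Rightarrow> complex"
  assumes scaleC_add_right: "c *\<^sub>C (x + y) = c *\<^sub>C x + c *\<^sub>C y"
    and scaleC_add_left: "(c + d) *\<^sub>C x = c *\<^sub>C x + d *\<^sub>C x"
    and scaleC_scaleC: "c *\<^sub>C d *\<^sub>C x = (c * d) *\<^sub>C x"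
    and scaleR_scaleC: "r *\<^sub>R x = complex_of_real r *\<^sub>C x"
    and cinner_add_left: "cinner (x + y) z = cinner x z + cinner y z"
    and cinner_scaleC_left: "cinner (c *\<^sub>C x) y = c * cinner x y"
    and cinner_commute: "cinner x y = cnj (cinner y x)"
    and inner_eq_Re_cinner: "inner x y = Re (cinner x y)"

instantiation complex :: complex_hilbert
begin

definition scaleC_complex :: "complex \<Rightarrow> complex \<Rightarrow> complex" where
  "scaleC_complex c x = c * x"

definition cinner_complex :: "complex \<Rightarrow> complex \<Rightarrow> complex" where
  "cinner_complex x y = x * cnj y"

instance
  by standard
    (auto simp: scaleC_complex_def cinner_complex_def algebra_simps scaleR_conv_of_real
      inner_complex_def)

end

definition ortho_complement :: "'a::complex_hilbert set \<Rightarrow> 'a set" where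
  "ortho_complement S = {y. \<forall>x\<in>S. cinner y x = 0}"

text \<open>
  Operators between closed subspaces of a Hilbert space are represented by functions on the whole
  type of which only the values on the domain matter.  Thus the restriction of an operator to a
  reducing subspace is the same function, considered on a smaller domain.
\<close>

definition nullspace_on :: "'a::complex_hilbert set \<Rightarrow> ('a \<Rightarrow> 'a) \<Rightarrow> 'a set" where
  "nullspace_on M T = {x\<in>M. T x = 0}"

definition bounded_op :: "'a::complex_hilbert set \<Rightarrow> 'a set \<Rightarrow> ('a \<Rightarrow> 'a) \<Rightarrow> bool" where
  "bounded_op M N T \<longleftrightarrow>
     T ` M \<subseteq> N \<and>
     (\<forall>x\<in>M. \<forall>y\<in>M. T (x + y) = T x + T y) \<and>
     (\<forall>c. \<forall>x\<in>M. T (c *\<^sub>C x) = c *\<^sub>C T x) \<and>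
     (\<exists>K. \<forall>x\<in>M. norm (T x) \<le> K * norm x)"

text \<open>The analogue of \<^const>\<open>onorm\<close>, relative to the domain.\<close>

definition onorm_on :: "'a::complex_hilbert set \<Rightarrow> ('a \<Rightarrow> 'a) \<Rightarrow> real" where
  "onorm_on M T = (SUP x\<in>M. norm (T x) / norm x)"

definition adjoint_pair ::
    "'a::complex_hilbert set \<Rightarrow> 'a set \<Rightarrow> ('a \<Rightarrow> 'a) \<Rightarrow> ('a \<Rightarrow> 'a) \<Rightarrow> bool" where
  "adjoint_pair M N T T' \<longleftrightarrow>
     bounded_op M N T \<and> bounded_op N M T' \<and>
     (\<forall>x\<in>M. \<forall>y\<in>N. cinner (T x) y = cinner x (T' y))"

definition selfadjoint_op :: "'a::complex_hilbert set \<Rightarrow> ('a \<Rightarrow> 'a) \<Rightarrow> bool" where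
  "selfadjoint_op M T \<longleftrightarrow> adjoint_pair M M T T"

definition orthogonal_projection :: "'a::complex_hilbert set \<Rightarrow> ('a \<Rightarrow> 'a) \<Rightarrow> bool" where
  "orthogonal_projection M P \<longleftrightarrow> selfadjoint_op M P \<and> (\<forall>x\<in>M. P (P x) = P x)"

text \<open>
  The exponential series, summed pointwise; for a bounded operator on a closed subspace
  it also converges in operator norm, with the same sum.
\<close>

definition op_exp :: "('a::complex_hilbert \<Rightarrow> 'a) \<Rightarrow> 'a \<Rightarrow> 'a" where
  "op_exp T x = (\<Sum>n. (T ^^ n) x /\<^sub>R fact n)"

text \<open>The body says \<open>P X P = (1 - P) X (1 - P) = 0\<close>.\<close>

definition codiagonal :: "'a::complex_hilbert set \<Rightarrow> ('a \<Rightarrow> 'a) \<Rightarrow> ('a \<Rightarrow> 'a) \<Rightarrow> bool" where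
  "codiagonal M P X \<longleftrightarrow>
     (\<forall>x\<in>M. P (X (P x)) = 0 \<and> X (x - P x) - P (X (x - P x)) = 0)"

text \<open>
  \<open>X\<close> is the exponent of the minimal geodesic joining the projections \<open>P\<close> and \<open>Q\<close> of \<open>M\<close>;
  it is the only such operator on \<open>M\<close> when \<open>P + Q - 1\<close> is injective on \<open>M\<close>.
\<close>

definition geodesic_exponent ::
    "'a::complex_hilbert set \<Rightarrow> ('a \<Rightarrow> 'a) \<Rightarrow> ('a \<Rightarrow> 'a) \<Rightarrow> ('a \<Rightarrow> 'a) \<Rightarrow> bool" where
  "geodesic_exponent M P Q X \<longleftrightarrow>
     selfadjoint_op M X \<and>
     onorm_on M X \<le> pi / 2 \<and>
     codiagonal M P X \<and>
     (\<forall>x\<in>M. op_exp (\<lambda>y. \<i> *\<^sub>C X y) (P (op_exp (\<lambda>y. (- \<i>) *\<^sub>C X y) x)) = Q x)"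

definition orthonormal_family :: "'i set \<Rightarrow> ('i \<Rightarrow> 'a::complex_hilbert) \<Rightarrow> bool" where
  "orthonormal_family I e \<longleftrightarrow>
     (\<forall>i\<in>I. \<forall>j\<in>I. cinner (e i) (e j) = (if i = j then 1 else 0))"

text \<open>
  Orthonormal families in a Hilbert space have at most as many members as the space has elements,
  so it is no restriction to take index sets in the carrier type.  They may be empty, finite,
  or uncountable.  Sums are unconditional sums in norm, at each vector.
\<close>

definition S_decomposable :: "'a::complex_hilbert set \<Rightarrow> 'a set \<Rightarrow> ('a \<Rightarrow> 'a) \<Rightarrow> bool" where
  "S_decomposable M N T \<longleftrightarrow>
     bounded_op M N T \<and>
     (\<exists>(I :: 'a set) (s :: 'a \<Rightarrow> real) \<xi> \<psi>.
        \<xi> ` I \<subseteq> M \<and> orthonormal_family I \<xi> \<and>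
        \<psi> ` I \<subseteq> N \<and> orthonormal_family I \<psi> \<and>
        (\<forall>n\<in>I. s n > 0) \<and>
        (\<forall>x\<in>M. ((\<lambda>n. s n *\<^sub>R cinner x (\<xi> n) *\<^sub>C \<psi> n) has_sum T x) I))"

definition orthonormal_basis :: "'a::complex_hilbert set \<Rightarrow> 'a set \<Rightarrow> bool" where
  "orthonormal_basis M B \<longleftrightarrow>
     B \<subseteq> M \<and> orthonormal_family B (\<lambda>b. b) \<and>
     (\<forall>x\<in>M. ((\<lambda>b. cinner x b *\<^sub>C b) has_sum x) B)"

definition diagonalizable :: "'a::complex_hilbert set \<Rightarrow> ('a \<Rightarrow> 'a) \<Rightarrow> bool" where
  "diagonalizable M A \<longleftrightarrow>
     selfadjoint_op M A \<and>
     (\<exists>B. orthonormal_basis M B \<and> (\<forall>b\<in>B. \<exists>c. A b = c *\<^sub>C b))"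

end

theory Submission
  imports Defs
begin

text \<open>
  All three properties are reduced to totality of the eigenvectors of a self-adjoint operator.
  An operator \<open>T\<close> is S-decomposable iff the eigenvectors of \<open>T T*\<close> are total.
  Put \<open>S = 2 P - 1\<close> and \<open>U t = exp (\<i> t X)\<close>.  Codiagonality says \<open>S X = - X S\<close>, so
  \<open>S (U (- t)) = (U t) S\<close>, hence \<open>4 P Q v = 2 v + U 2 v + U (- 2) v = 4 cos\<^sup>2 X v\<close> for
  \<open>v\<close> in the range of \<open>P'\<close>; on that range \<open>Z Z* = X\<^sup>2\<close>.  It remains to see that
  \<open>cos\<^sup>2 X v = cos\<^sup>2 a v\<close> with \<open>0 \<le> a < \<pi>/2\<close> forces \<open>X\<^sup>2 v = a\<^sup>2 v\<close>.  The hypothesis factors as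
  \<open>(U 2 - e\<^bsup>2 \<i> a\<^esup>) (U 2 - e\<^bsup>- 2 \<i> a\<^esup>) v = 0\<close>, so it is enough that
  \<open>U 2 w = e\<^bsup>2 \<i> b\<^esup> w\<close> with \<open>\<bar>b\<bar> < \<pi>/2\<close> implies \<open>X w = b w\<close>.  In place of a functional
  calculus, this uses geometry on spheres: along the closed curve \<open>e\<^bsup>- \<i> t b\<^esup> U t w\<close>,
  \<open>- 1 \<le> t \<le> 1\<close>, the velocity at time \<open>t\<close> makes an angle of at most \<open>c \<bar>t\<bar>\<close> with the one at
  time 0, where \<open>c = \<parallel>X - b\<parallel> < \<pi>\<close>, so the velocities can average to zero only if they vanish.
\<close>

section \<open>Complex Hilbert spaces\<close>

instance complex_hilbert \<subseteq> banach ..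

lemma scaleC_one [simp]: "1 *\<^sub>C x = x"
  using scaleR_scaleC[of 1 x] by simp

lemma scaleC_zero_left [simp]: "0 *\<^sub>C x = 0"
  using scaleR_scaleC[of 0 x] by simp

lemma scaleC_zero_right [simp]: "c *\<^sub>C 0 = 0"
  using scaleC_add_right[of c 0 0] by simp

lemma scaleC_minus_left [simp]: "(- c) *\<^sub>C x = - (c *\<^sub>C x)"
  using scaleC_add_left[of c "- c" x] by (simp add: eq_neg_iff_add_eq_0 add.commute)

lemma scaleC_minus_right [simp]: "c *\<^sub>C (- x) = - (c *\<^sub>C x)"
  using scaleC_add_right[of c x "- x"] by (simp add: eq_neg_iff_add_eq_0 add.commute)

lemma scaleC_diff_left: "(c - d) *\<^sub>C x = c *\<^sub>C x - d *\<^sub>C x"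
  using scaleC_add_left[of c "- d" x] by simp

lemma scaleC_diff_right: "c *\<^sub>C (x - y) = c *\<^sub>C x - c *\<^sub>C y"
  using scaleC_add_right[of c x "- y"] by simp

lemma scaleC_scaleR_right: "c *\<^sub>C r *\<^sub>R x = r *\<^sub>R c *\<^sub>C x"
  by (simp add: scaleR_scaleC scaleC_scaleC mult.commute)

lemma cinner_add_right: "cinner x (y + z) = cinner x y + cinner x z"
  by (metis cinner_add_left cinner_commute complex_cnj_add)

lemma cinner_scaleC_right: "cinner x (c *\<^sub>C y) = cnj c * cinner x y"
  by (metis cinner_scaleC_left cinner_commute complex_cnj_mult)

lemma cinner_zero_left [simp]: "cinner 0 y = 0"
  using cinner_add_left[of 0 0 y] by simp

lemma cinner_zero_right [simp]: "cinner x 0 = 0"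
  using cinner_add_right[of x 0 0] by simp

lemma cinner_minus_left: "cinner (- x) y = - cinner x y"
  using cinner_add_left[of x "- x" y] by (simp add: eq_neg_iff_add_eq_0 add.commute)

lemma cinner_minus_right: "cinner x (- y) = - cinner x y"
  using cinner_add_right[of x y "- y"] by (simp add: eq_neg_iff_add_eq_0 add.commute)

lemma cinner_diff_left: "cinner (x - y) z = cinner x z - cinner y z"
  using cinner_add_left[of x "- y" z] by (simp add: cinner_minus_left)

lemma cinner_diff_right: "cinner x (y - z) = cinner x y - cinner x z"
  using cinner_add_right[of x y "- z"] by (simp add: cinner_minus_right)

lemma cinner_self: "cinner x x = complex_of_real ((norm x)\<^sup>2)"
proof (rule complex_eqI)
  show "Re (cinner x x) = Re (complex_of_real ((norm x)\<^sup>2))"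
    by (simp add: inner_eq_Re_cinner[symmetric] power2_norm_eq_inner)
  have "Im (cinner x x) = - Im (cinner x x)"
    using cinner_commute[of x x] by (metis cnj.simps(2))
  then show "Im (cinner x x) = Im (complex_of_real ((norm x)\<^sup>2))" by simp
qed

lemma cinner_self_eq_0 [simp]: "cinner x x = 0 \<longleftrightarrow> x = 0"
  by (simp add: cinner_self)

lemma cinner_eq_0_commute: "cinner x y = 0 \<longleftrightarrow> cinner y x = 0"
  by (metis cinner_commute complex_cnj_zero)

lemma scaleC_eq_0_iff [simp]: "c *\<^sub>C x = 0 \<longleftrightarrow> c = 0 \<or> x = 0"
proof
  assume "c *\<^sub>C x = 0"
  then have "cinner (c *\<^sub>C x) (c *\<^sub>C x) = 0" by simp
  then have "c * (cnj c * cinner x x) = 0"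
    by (simp only: cinner_scaleC_left cinner_scaleC_right mult.left_commute)
  then show "c = 0 \<or> x = 0" by auto
qed auto

lemma norm_scaleC [simp]: "norm (c *\<^sub>C x) = norm c * norm x"
proof -
  have "complex_of_real ((norm (c *\<^sub>C x))\<^sup>2) = c * cnj c * cinner x x"
    using cinner_self[of "c *\<^sub>C x"] by (simp add: cinner_scaleC_left cinner_scaleC_right mult_ac)
  also have "\<dots> = complex_of_real ((norm c * norm x)\<^sup>2)"
    using cinner_self[of x] complex_norm_square[of c] by (simp add: power_mult_distrib)
  finally have "complex_of_real ((norm (c *\<^sub>C x))\<^sup>2) = complex_of_real ((norm c * norm x)\<^sup>2)" .
  then show ?thesis
    by (simp only: of_real_eq_iff power2_eq_iff_nonneg norm_ge_zero mult_nonneg_nonneg)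
qed

text \<open>The unimodular factor \<open>u\<close> rotates \<open>cinner x y\<close> onto the
  positive real axis, where the Cauchy-Schwarz inequality of the real inner product applies.\<close>

lemma norm_cinner_le: "norm (cinner x y) \<le> norm x * norm y"
proof (cases "cinner x y = 0")
  case False
  define u where "u = cnj (sgn (cinner x y))"
  have u: "norm u = 1" using False by (simp add: u_def norm_sgn)
  have "cinner x y * cnj (cinner x y) = complex_of_real (norm (cinner x y)) * norm (cinner x y)"
    by (simp add: complex_norm_square[symmetric] power2_eq_square)
  then have "u * cinner x y = complex_of_real (norm (cinner x y))"
    using False by (simp add: u_def sgn_div_norm scaleR_conv_of_real field_simps)
  then have "norm (cinner x y) = inner (u *\<^sub>C x) y"
    by (simp add: inner_eq_Re_cinner cinner_scaleC_left)
  also have "\<dots> \<le> norm (u *\<^sub>C x) * norm y"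
    by (rule norm_cauchy_schwarz)
  finally show ?thesis by (simp add: u)
qed simp

lemma scaleC_scaleR_left: "(r *\<^sub>R c) *\<^sub>C x = r *\<^sub>R c *\<^sub>C x"
  by (simp add: scaleR_scaleC[of r "c *\<^sub>C x"] scaleC_scaleC scaleR_conv_of_real)

lemma cinner_scaleR_left: "cinner (r *\<^sub>R x) y = r *\<^sub>R cinner x y"
  by (simp add: scaleR_scaleC[of r x] cinner_scaleC_left scaleR_conv_of_real)

lemma cinner_scaleR_right: "cinner x (r *\<^sub>R y) = r *\<^sub>R cinner x y"
  by (simp add: scaleR_scaleC[of r y] cinner_scaleC_right scaleR_conv_of_real)

lemma bounded_bilinear_scaleC: "bounded_bilinear (\<lambda>c (x::'a::complex_hilbert). c *\<^sub>C x)"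
  by standard
    (auto simp: scaleC_add_left scaleC_add_right scaleC_scaleR_right scaleC_scaleR_left intro!: exI[of _ 1])

lemma bounded_bilinear_cinner: "bounded_bilinear (cinner :: 'a::complex_hilbert \<Rightarrow> 'a \<Rightarrow> complex)"
  by standard
    (auto simp: cinner_add_left cinner_add_right cinner_scaleR_left cinner_scaleR_right intro!: exI[of _ 1] norm_cinner_le)

lemmas bounded_linear_scaleC_right = bounded_bilinear.bounded_linear_right[OF bounded_bilinear_scaleC]
  and bounded_linear_cinner_left = bounded_bilinear.bounded_linear_left[OF bounded_bilinear_cinner]
  and bounded_linear_cinner_right = bounded_bilinear.bounded_linear_right[OF bounded_bilinear_cinner]

section \<open>Closed complex subspaces\<close>

definition closed_csubspace :: "'a::complex_hilbert set \<Rightarrow> bool" where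
  "closed_csubspace M \<longleftrightarrow>
     closed M \<and> 0 \<in> M \<and> (\<forall>x\<in>M. \<forall>y\<in>M. x + y \<in> M) \<and> (\<forall>c. \<forall>x\<in>M. c *\<^sub>C x \<in> M)"

lemma closed_csubspaceD:
  assumes "closed_csubspace M"
  shows "closed M" and "0 \<in> M"
    and "\<And>x y. x \<in> M \<Longrightarrow> y \<in> M \<Longrightarrow> x + y \<in> M"
    and "\<And>c x. x \<in> M \<Longrightarrow> c *\<^sub>C x \<in> M"
    and "\<And>x. x \<in> M \<Longrightarrow> - x \<in> M"
    and "\<And>x y. x \<in> M \<Longrightarrow> y \<in> M \<Longrightarrow> x - y \<in> M"
    and "\<And>r x. x \<in> M \<Longrightarrow> r *\<^sub>R x \<in> M"
    and "\<And>I (f :: 'i \<Rightarrow> _). (\<And>i. i \<in> I \<Longrightarrow> f i \<in> M) \<Longrightarrow> sum f I \<in> M"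
proof -
  note * = assms[unfolded closed_csubspace_def]
  show "closed M" and z: "0 \<in> M" and p: "\<And>x y. x \<in> M \<Longrightarrow> y \<in> M \<Longrightarrow> x + y \<in> M"
    and c: "\<And>c x. x \<in> M \<Longrightarrow> c *\<^sub>C x \<in> M"
    using * by auto
  show m: "- x \<in> M" if "x \<in> M" for x
    using c[OF that, of "- 1"] by simp
  show "x - y \<in> M" if "x \<in> M" "y \<in> M" for x y
    using p[OF that(1) m[OF that(2)]] by simp
  show "r *\<^sub>R x \<in> M" if "x \<in> M" for r x
    using c[OF that] by (simp add: scaleR_scaleC)
  show "sum f I \<in> M" if "\<And>i. i \<in> I \<Longrightarrow> f i \<in> M" for I and f :: "'i \<Rightarrow> _"
    using that by (induction I rule: infinite_finite_induct) (auto intro: z p)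
qed

lemma closed_csubspace_UNIV [simp]: "closed_csubspace UNIV"
  by (simp add: closed_csubspace_def)

lemma closed_csubspace_ortho_complement: "closed_csubspace (ortho_complement S)"
proof -
  have "closed (ortho_complement S)"
  proof -
    have "ortho_complement S = (\<Inter>x\<in>S. (\<lambda>y. cinner y x) -` {0})"
      by (auto simp: ortho_complement_def)
    moreover have "closed ((\<lambda>y. cinner y x) -` {0})" for x :: 'a
      by (intro closed_vimage closed_singleton)
        (rule linear_continuous_on[OF bounded_linear_cinner_left])
    ultimately show ?thesis by auto
  qed
  then show ?thesis
    by (auto simp: closed_csubspace_def ortho_complement_def cinner_add_left cinner_scaleC_left)
qed

lemma has_sum_in_closed_csubspace:
  assumes "closed_csubspace M" and "(f has_sum s) I" and "\<And>i. i \<in> I \<Longrightarrow> f i \<in> M"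
  shows "s \<in> M"
proof -
  have "(sum f \<longlongrightarrow> s) (finite_subsets_at_top I)"
    using assms(2) by (simp add: has_sum_def)
  moreover have "\<forall>\<^sub>F F in finite_subsets_at_top I. sum f F \<in> M"
    using assms(3) by (intro eventually_finite_subsets_at_top_weakI closed_csubspaceD(8)[OF assms(1)]) auto
  ultimately show ?thesis
    using Lim_in_closed_set closed_csubspaceD(1)[OF assms(1)] finite_subsets_at_top_neq_bot by blast
qed

section \<open>Bounded operators relative to their domains\<close>

lemma bounded_opD:
  assumes "bounded_op M N T"
  shows "\<And>x. x \<in> M \<Longrightarrow> T x \<in> N"
    and "\<And>x y. x \<in> M \<Longrightarrow> y \<in> M \<Longrightarrow> T (x + y) = T x + T y"
    and "\<And>c x. x \<in> M \<Longrightarrow> T (c *\<^sub>C x) = c *\<^sub>C T x"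
    and "\<And>x. x \<in> M \<Longrightarrow> T (- x) = - T x"
    and "\<exists>K. \<forall>x\<in>M. norm (T x) \<le> K * norm x"
proof -
  note * = assms[unfolded bounded_op_def]
  show "\<And>x. x \<in> M \<Longrightarrow> T x \<in> N" "\<And>x y. x \<in> M \<Longrightarrow> y \<in> M \<Longrightarrow> T (x + y) = T x + T y"
    "\<And>c x. x \<in> M \<Longrightarrow> T (c *\<^sub>C x) = c *\<^sub>C T x" "\<exists>K. \<forall>x\<in>M. norm (T x) \<le> K * norm x"
    using * by auto
  show "T (- x) = - T x" if "x \<in> M" for x
    using * that by (metis scaleC_minus_left scaleC_one)
qed

lemma bounded_op_diff:
  assumes "bounded_op M N T" "closed_csubspace M" "x \<in> M" "y \<in> M"
  shows "T (x - y) = T x - T y"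
proof -
  have "T (x - y) = T (x + - y)" by simp
  also have "\<dots> = T x + T (- y)"
    using assms by (intro bounded_opD(2)[OF assms(1)] closed_csubspaceD(5)) auto
  finally show ?thesis using bounded_opD(4)[OF assms(1,4)] by simp
qed

lemma bounded_op_zero:
  assumes "bounded_op M N T" "closed_csubspace M"
  shows "T 0 = 0"
  using bounded_op_diff[OF assms closed_csubspaceD(2)[OF assms(2)] closed_csubspaceD(2)[OF assms(2)]]
  by simp

lemma bounded_op_compose:
  assumes S: "bounded_op N L S" and T: "bounded_op M N T"
  shows "bounded_op M L (\<lambda>x. S (T x))"
proof -
  obtain K where K: "\<And>x. x \<in> N \<Longrightarrow> norm (S x) \<le> K * norm x"
    using bounded_opD(5)[OF S] by blast
  obtain K' where K': "\<And>x. x \<in> M \<Longrightarrow> norm (T x) \<le> K' * norm x"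
    using bounded_opD(5)[OF T] by blast
  have "norm (S (T x)) \<le> (\<bar>K\<bar> * K') * norm x" if "x \<in> M" for x
  proof -
    have "norm (S (T x)) \<le> K * norm (T x)"
      using K bounded_opD(1)[OF T that] by blast
    also have "\<dots> \<le> \<bar>K\<bar> * norm (T x)"
      by (intro mult_right_mono) auto
    also have "\<dots> \<le> \<bar>K\<bar> * (K' * norm x)"
      using K'[OF that] by (intro mult_left_mono) auto
    finally show ?thesis by (simp add: mult.assoc)
  qed
  then have "\<exists>K. \<forall>x\<in>M. norm (S (T x)) \<le> K * norm x" by blast
  then show ?thesis
    unfolding bounded_op_def
    using bounded_opD(1,2,3)[OF S] bounded_opD(1,2,3)[OF T] by auto
qed

lemma adjoint_pair_selfadjoint_op:
  assumes "adjoint_pair M N T T'"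
  shows "selfadjoint_op N (\<lambda>y. T (T' y))"
proof -
  have T: "bounded_op M N T" and T': "bounded_op N M T'"
    and adj: "\<And>x y. x \<in> M \<Longrightarrow> y \<in> N \<Longrightarrow> cinner (T x) y = cinner x (T' y)"
    using assms by (auto simp: adjoint_pair_def)
  have "cinner (T (T' x)) y = cinner x (T (T' y))" if "x \<in> N" "y \<in> N" for x y
  proof -
    have "T' x \<in> M" "T' y \<in> M"
      using bounded_opD(1)[OF T'] that by auto
    then show ?thesis
      using adj that by (metis cinner_commute)
  qed
  then show ?thesis
    using bounded_op_compose[OF T T'] by (auto simp: selfadjoint_op_def adjoint_pair_def)
qed

section \<open>Orthonormal sets\<close>

lemma orthonormal_familyD:
  assumes "orthonormal_family B (\<lambda>b. b)"
  shows "b \<in> B \<Longrightarrow> cinner b b = 1"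
    and "b \<in> B \<Longrightarrow> b' \<in> B \<Longrightarrow> b \<noteq> b' \<Longrightarrow> cinner b b' = 0"
    and "b \<in> B \<Longrightarrow> norm b = 1"
proof -
  show *: "b \<in> B \<Longrightarrow> cinner b b = 1" and "b \<in> B \<Longrightarrow> b' \<in> B \<Longrightarrow> b \<noteq> b' \<Longrightarrow> cinner b b' = 0"
    using assms by (auto simp: orthonormal_family_def)
  assume "b \<in> B"
  then have "complex_of_real ((norm b)\<^sup>2) = 1"
    using * cinner_self[of b] by simp
  then have "(norm b)\<^sup>2 = 1\<^sup>2" by (metis of_real_eq_1_iff one_power2)
  then show "norm b = 1" by (simp only: power2_eq_iff_nonneg norm_ge_zero zero_le_one)
qed

lemma orthonormal_norm_sum:
  assumes "orthonormal_family B (\<lambda>b. b)" "finite F" "F \<subseteq> B"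
  shows "(norm (\<Sum>b\<in>F. c b *\<^sub>C b))\<^sup>2 = (\<Sum>b\<in>F. (norm (c b))\<^sup>2)"
  using assms(2,3)
proof (induction F rule: finite_induct)
  case (insert b F)
  have "cinner (\<Sum>b\<in>F. c b *\<^sub>C b) b = (\<Sum>b'\<in>F. c b' * cinner b' b)"
    by (simp add: cinner_scaleC_left
        linear_sum[OF bounded_linear.linear[OF bounded_linear_cinner_left]])
  also have "\<dots> = 0"
    using insert orthonormal_familyD(2)[OF assms(1)] by (intro sum.neutral) auto
  finally have "cinner b (\<Sum>b\<in>F. c b *\<^sub>C b) = 0"
    by (metis cinner_eq_0_commute)
  then have "inner (c b *\<^sub>C b) (\<Sum>b\<in>F. c b *\<^sub>C b) = 0"
    by (simp add: inner_eq_Re_cinner cinner_scaleC_left)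
  then have "(norm (c b *\<^sub>C b + (\<Sum>b\<in>F. c b *\<^sub>C b)))\<^sup>2
      = (norm (c b *\<^sub>C b))\<^sup>2 + (norm (\<Sum>b\<in>F. c b *\<^sub>C b))\<^sup>2"
    by (intro norm_add_Pythagorean) (simp add: orthogonal_def)
  then show ?case
    using insert orthonormal_familyD(3)[OF assms(1)] by auto
qed simp

lemma bessel:
  assumes B: "orthonormal_family B (\<lambda>b. b)" and F: "finite F" "F \<subseteq> B"
  shows "(\<Sum>b\<in>F. (norm (cinner x b))\<^sup>2) \<le> (norm x)\<^sup>2"
proof -
  define y where "y = (\<Sum>b\<in>F. cinner x b *\<^sub>C b)"
  have "cinner x y = (\<Sum>b\<in>F. cinner x (cinner x b *\<^sub>C b))"
    unfolding y_def by (rule linear_sum[OF bounded_linear.linear[OF bounded_linear_cinner_right]])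
  also have "\<dots> = complex_of_real (\<Sum>b\<in>F. (norm (cinner x b))\<^sup>2)"
    by (simp only: cinner_scaleC_right complex_norm_square of_real_sum mult.commute)
  finally have xy: "inner x y = (\<Sum>b\<in>F. (norm (cinner x b))\<^sup>2)"
    by (simp add: inner_eq_Re_cinner)
  have yy: "inner y y = (\<Sum>b\<in>F. (norm (cinner x b))\<^sup>2)"
    using orthonormal_norm_sum[OF B F, of "cinner x"] by (simp add: y_def power2_norm_eq_inner)
  have "0 \<le> inner (x - y) (x - y)" by simp
  then show ?thesis
    using xy yy by (simp add: inner_diff_left inner_diff_right inner_commute power2_norm_eq_inner)
qed

text \<open>Bessel's inequality makes the squared coefficients summable. By Pythagoras they control
  the squared norms of differences of partial sums, so these form a Cauchy net, which converges by
  completeness.\<close>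

lemma orthonormal_summable_on:
  assumes B: "orthonormal_family B (\<lambda>b. b)"
  shows "(\<lambda>b. cinner x b *\<^sub>C b) summable_on B"
proof -
  let ?f = "\<lambda>b. cinner x b *\<^sub>C b" and ?g = "\<lambda>b. (norm (cinner x b))\<^sup>2"
  have "?g summable_on B"
    using bessel[OF B, of _ x]
    by (intro nonneg_bounded_partial_sums_imp_summable_on[where C = "(norm x)\<^sup>2"]
        eventually_finite_subsets_at_top_weakI) auto
  then obtain L where lim: "(sum ?g \<longlongrightarrow> L) (finite_subsets_at_top B)"
    unfolding has_sum_def summable_on_def by blast
  have "\<exists>P. eventually P (finite_subsets_at_top B) \<and>
      (\<forall>F F'. P F \<and> P F' \<longrightarrow> dist (sum ?f F) (sum ?f F') < e)" if "e > 0" for e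
  proof -
    \<comment> \<open>Partial sums of \<open>?g\<close> within \<open>d\<close> of \<open>L\<close>
      differ by less than \<open>2 * d\<close>, which is \<open>(e / 2)^2\<close>.\<close>
    define d where "d = e\<^sup>2 / 8"
    have "d > 0" using that by (simp add: d_def)
    have "\<forall>\<^sub>F F in finite_subsets_at_top B. dist (sum ?g F) L < d"
      using lim \<open>d > 0\<close> by (simp add: tendsto_iff)
    then obtain F0 where F0: "finite F0" "F0 \<subseteq> B"
      "\<And>F. finite F \<Longrightarrow> F0 \<subseteq> F \<Longrightarrow> F \<subseteq> B \<Longrightarrow> dist (sum ?g F) L < d"
      unfolding eventually_finite_subsets_at_top by metis
    define P where "P F \<longleftrightarrow> finite F \<and> F0 \<subseteq> F \<and> F \<subseteq> B" for F
    have near: "norm (sum ?f F - sum ?f F0) < e / 2" if "P F" for F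
    proof -
      have F: "finite F" "F0 \<subseteq> F" "F \<subseteq> B" using that by (auto simp: P_def)
      have "(norm (sum ?f F - sum ?f F0))\<^sup>2 = (norm (sum ?f (F - F0)))\<^sup>2"
        using F by (subst sum_diff) auto
      also have "\<dots> = sum ?g (F - F0)"
        using F by (intro orthonormal_norm_sum[OF B]) auto
      also have "\<dots> = sum ?g F - sum ?g F0"
        using F by (subst sum_diff) auto
      also have "\<dots> < 2 * d"
        using F0(3)[OF F] F0(3)[OF F0(1) order.refl F0(2)] by (auto simp: dist_real_def abs_less_iff)
      also have "\<dots> = (e / 2)\<^sup>2"
        by (simp add: d_def power2_eq_square)
      finally show ?thesis
        using \<open>e > 0\<close> by (rule_tac power2_less_imp_less) auto
    qed
    have "dist (sum ?f F) (sum ?f F') < e" if "P F" "P F'" for F F'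
      using near[OF that(1)] near[OF that(2)] dist_triangle_half_l[of "sum ?f F" "sum ?f F0" e "sum ?f F'"]
      by (simp add: dist_norm)
    moreover have "eventually P (finite_subsets_at_top B)"
      unfolding eventually_finite_subsets_at_top P_def using F0 by blast
    ultimately show ?thesis by blast
  qed
  then have "cauchy_filter (filtermap (sum ?f) (finite_subsets_at_top B))"
    by (simp add: cauchy_filter_metric_filtermap)
  moreover have "complete (UNIV :: 'a set)"
    by (meson Cauchy_convergent UNIV_I complete_def convergent_def)
  ultimately obtain s where "(sum ?f \<longlongrightarrow> s) (finite_subsets_at_top B)"
    using complete_uniform[where S=UNIV] by (force simp: filterlim_def)
  then show ?thesis
    using summable_on_def has_sum_def by blast
qed

text \<open>Projection onto the closed span of \<open>B\<close>, with \<open>y\<close> the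
  orthogonal component of \<open>x\<close>. Pairing the expansion with one \<open>b\<close> leaves
  the single term \<open>cinner x b\<close>.\<close>

lemma orthonormal_residual:
  assumes B: "orthonormal_family B (\<lambda>b. b)" "B \<subseteq> M" and M: "closed_csubspace M" and x: "x \<in> M"
    and y: "y = x - (\<Sum>\<^sub>\<infinity>b\<in>B. cinner x b *\<^sub>C b)"
  shows "y \<in> M" and "\<And>b. b \<in> B \<Longrightarrow> cinner y b = 0"
    and "((\<lambda>b. cinner x b *\<^sub>C b) has_sum (x - y)) B"
proof -
  show s: "((\<lambda>b. cinner x b *\<^sub>C b) has_sum (x - y)) B"
    using orthonormal_summable_on[OF B(1), of x] by (simp add: y)
  then have "x - y \<in> M"
    using B(2) by (intro has_sum_in_closed_csubspace[OF M s] closed_csubspaceD(4)[OF M]) auto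
  then show "y \<in> M"
    using closed_csubspaceD(6)[OF M x] by fastforce
  show "cinner y b = 0" if "b \<in> B" for b
  proof -
    have "((\<lambda>b'. cinner (cinner x b' *\<^sub>C b') b) has_sum cinner (x - y) b) B"
      by (rule has_sum_bounded_linear[OF bounded_linear_cinner_left s])
    moreover have "((\<lambda>b'. cinner (cinner x b' *\<^sub>C b') b) has_sum cinner x b) B
        \<longleftrightarrow> ((\<lambda>b'. cinner x b) has_sum cinner x b) {b}"
      using that orthonormal_familyD[OF B(1)]
      by (intro has_sum_cong_neutral) (auto simp: cinner_scaleC_left)
    moreover have "((\<lambda>b'. cinner x b) has_sum cinner x b) {b}"
      by (simp add: has_sum_finite_iff)
    ultimately have "cinner (x - y) b = cinner x b"
      using has_sum_unique by blast
    then show ?thesis by (simp add: cinner_diff_left)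
  qed
qed

section \<open>Total systems of eigenvectors\<close>

text \<open>The zero vector is counted as an eigenvector.\<close>

definition eigenvectors :: "'a::complex_hilbert set \<Rightarrow> ('a \<Rightarrow> 'a) \<Rightarrow> 'a set" where
  "eigenvectors M A = {e\<in>M. \<exists>c. A e = c *\<^sub>C e}"

text \<open>Totality involves single eigenvectors only, so it passes between operators more easily
  than a basis; \<open>ex_orthonormal_basis_eigenvectors\<close> recovers the basis.\<close>

definition eigenvectors_total :: "'a::complex_hilbert set \<Rightarrow> ('a \<Rightarrow> 'a) \<Rightarrow> bool" where
  "eigenvectors_total M A \<longleftrightarrow> (\<forall>x\<in>M. (\<forall>e\<in>eigenvectors M A. cinner x e = 0) \<longrightarrow> x = 0)"

text \<open>An eigenvector that is orthogonal to all eigenvectors is orthogonal to itself.\<close>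

lemma eigenvectors_totalI:
  assumes "\<And>x. x \<in> M \<Longrightarrow> (\<And>e. e \<in> eigenvectors M A \<Longrightarrow> cinner x e = 0) \<Longrightarrow> x \<in> eigenvectors M A"
  shows "eigenvectors_total M A"
proof (unfold eigenvectors_total_def, intro ballI impI)
  fix x assume "x \<in> M" "\<forall>e\<in>eigenvectors M A. cinner x e = 0"
  then have "cinner x x = 0" using assms by blast
  then show "x = 0" by simp
qed

lemma eigenvectors_totalD:
  assumes "eigenvectors_total M A" "x \<in> M" "\<And>e. e \<in> eigenvectors M A \<Longrightarrow> cinner x e = 0"
  shows "x = 0"
  using assms by (auto simp: eigenvectors_total_def)

lemma selfadjoint_opD:
  assumes "selfadjoint_op M A"
  shows "bounded_op M M A"
    and "\<And>x. x \<in> M \<Longrightarrow> A x \<in> M"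
    and "\<And>x y. x \<in> M \<Longrightarrow> y \<in> M \<Longrightarrow> cinner (A x) y = cinner x (A y)"
  using assms bounded_opD(1) by (auto simp: selfadjoint_op_def adjoint_pair_def)

text \<open>The case \<open>y = x\<close> shows that eigenvalues are real; after that, eigenvectors
  that are not orthogonal share their eigenvalue.\<close>

lemma selfadjoint_eigenvalue_eq:
  assumes A: "selfadjoint_op M A" and xy: "x \<in> M" "y \<in> M"
    and ev: "A x = c *\<^sub>C x" "A y = d *\<^sub>C y" and nz: "cinner x y \<noteq> 0"
  shows "cnj d = c"
proof -
  have "c * cinner x y = cnj d * cinner x y"
    using selfadjoint_opD(3)[OF A xy] ev by (simp add: cinner_scaleC_left cinner_scaleC_right)
  then show ?thesis using nz by simp
qed

text \<open>Only members of \<open>B\<close> with the eigenvalue of \<open>e\<close> have nonzero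
  coefficients, so the projection of \<open>e\<close>, and with it the residual, stays in the
  eigenspace. The eigenvalue equation is tested against each \<open>z\<close>: self-adjointness
  moves \<open>A\<close> onto \<open>z\<close> rather than through the infinite sum.\<close>

lemma eigenvectors_residual:
  assumes A: "selfadjoint_op M A" and M: "closed_csubspace M"
    and B: "orthonormal_family B (\<lambda>b. b)" "B \<subseteq> eigenvectors M A"
    and e: "e \<in> eigenvectors M A"
  shows "e - (\<Sum>\<^sub>\<infinity>b\<in>B. cinner e b *\<^sub>C b) \<in> eigenvectors M A"
proof -
  define y where "y = e - (\<Sum>\<^sub>\<infinity>b\<in>B. cinner e b *\<^sub>C b)"
  have BM: "B \<subseteq> M" and eM: "e \<in> M" using B(2) e by (auto simp: eigenvectors_def)
  obtain c where c: "A e = c *\<^sub>C e" using e by (auto simp: eigenvectors_def)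
  note y = orthonormal_residual[OF B(1) BM M eM y_def]
  have expand: "((\<lambda>b. cinner e b * cinner b w) has_sum cinner (e - y) w) B" for w
    using has_sum_bounded_linear[OF bounded_linear_cinner_left y(3), of w]
    by (simp add: cinner_scaleC_left)
  have "cinner (A y - c *\<^sub>C y) z = 0" if z: "z \<in> M" for z
  proof -
    have "cinner e b * cinner b (A z) = c * (cinner e b * cinner b z)" if b: "b \<in> B" for b
    proof (cases "cinner e b = 0")
      case False
      obtain d where d: "A b = d *\<^sub>C b" using B(2) b by (auto simp: eigenvectors_def)
      have bM: "b \<in> M" using BM b by auto
      have "cnj d = d"
        using selfadjoint_eigenvalue_eq[OF A bM bM d d] orthonormal_familyD(1)[OF B(1) b] by simp
      moreover have "cnj d = c"
        using selfadjoint_eigenvalue_eq[OF A eM bM c d False] .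
      moreover have "cinner b (A z) = d * cinner b z"
        using selfadjoint_opD(3)[OF A bM z] d by (simp add: cinner_scaleC_left)
      ultimately show ?thesis by simp
    qed simp
    then have "((\<lambda>b. cinner e b * cinner b (A z)) has_sum cinner (e - y) (A z)) B
        \<longleftrightarrow> ((\<lambda>b. c * (cinner e b * cinner b z)) has_sum cinner (e - y) (A z)) B"
      by (rule has_sum_cong)
    then have "((\<lambda>b. c * (cinner e b * cinner b z)) has_sum cinner (e - y) (A z)) B"
      using expand[of "A z"] by blast
    moreover have "((\<lambda>b. c * (cinner e b * cinner b z)) has_sum c * cinner (e - y) z) B"
      by (rule has_sum_cmult_right[OF expand])
    ultimately have "cinner (e - y) (A z) = c * cinner (e - y) z"
      using has_sum_unique by blast
    moreover have "cinner e (A z) = c * cinner e z"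
      using selfadjoint_opD(3)[OF A eM z] c by (simp add: cinner_scaleC_left)
    ultimately have "cinner y (A z) = c * cinner y z"
      by (simp add: cinner_diff_left algebra_simps)
    then show ?thesis
      using selfadjoint_opD(3)[OF A y(1) z] by (simp add: cinner_diff_left cinner_scaleC_left)
  qed
  moreover have "A y - c *\<^sub>C y \<in> M"
    using y(1) selfadjoint_opD(2)[OF A] closed_csubspaceD(4,6)[OF M] by auto
  ultimately have "cinner (A y - c *\<^sub>C y) (A y - c *\<^sub>C y) = 0"
    by blast
  then have "A y - c *\<^sub>C y = 0"
    by simp
  then show ?thesis
    using y(1) by (auto simp: eigenvectors_def y_def)
qed

lemma eigenvectors_scaleC:
  assumes A: "selfadjoint_op M A" and M: "closed_csubspace M" and e: "e \<in> eigenvectors M A"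
  shows "r *\<^sub>C e \<in> eigenvectors M A"
proof -
  obtain c where e: "e \<in> M" "A e = c *\<^sub>C e" using e by (auto simp: eigenvectors_def)
  then have "A (r *\<^sub>C e) = c *\<^sub>C r *\<^sub>C e"
    using bounded_opD(3)[OF selfadjoint_opD(1)[OF A] e(1)] by (simp add: scaleC_scaleC mult.commute)
  then show ?thesis
    using closed_csubspaceD(4)[OF M e(1)] by (auto simp: eigenvectors_def)
qed

text \<open>Zorn's lemma gives a maximal orthonormal set \<open>B\<close> of eigenvectors.
  Maximality makes every eigenvector equal to its expansion in \<open>B\<close>, and totality
  extends this to all of \<open>M\<close>.\<close>

lemma ex_orthonormal_basis_eigenvectors:
  assumes A: "selfadjoint_op M A" and M: "closed_csubspace M" and tot: "eigenvectors_total M A"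
  shows "\<exists>B. orthonormal_basis M B \<and> B \<subseteq> eigenvectors M A"
proof -
  define \<B> where "\<B> = {B. B \<subseteq> eigenvectors M A \<and> orthonormal_family B (\<lambda>b. b)}"
  have "\<exists>B\<in>\<B>. \<forall>X\<in>\<B>. B \<subseteq> X \<longrightarrow> X = B"
  proof (rule subset_Zorn')
    fix C assume C: "subset.chain \<B> C"
    have pair: "\<exists>Y\<in>C. {b, b'} \<subseteq> Y" if bb: "b \<in> \<Union>C" "b' \<in> \<Union>C" for b b'
    proof -
      obtain Y Y' where Y: "Y \<in> C" "Y' \<in> C" "b \<in> Y" "b' \<in> Y'" using bb by auto
      then have "Y \<subseteq> Y' \<or> Y' \<subseteq> Y"
        using C by (auto simp: subset_chain_def)
      then show ?thesis using Y by auto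
    qed
    have "orthonormal_family Y (\<lambda>b. b)" if "Y \<in> C" for Y
      using C that by (auto simp: \<B>_def subset_chain_def)
    then have "cinner b b' = (if b = b' then 1 else 0)" if "b \<in> \<Union>C" "b' \<in> \<Union>C" for b b'
      using pair[OF that] by (auto simp: orthonormal_family_def)
    then have "orthonormal_family (\<Union>C) (\<lambda>b. b)"
      by (simp add: orthonormal_family_def)
    then show "\<Union>C \<in> \<B>"
      using C by (auto simp: \<B>_def subset_chain_def)
  qed
  then obtain B where "B \<in> \<B>" and maxB: "\<forall>X\<in>\<B>. B \<subseteq> X \<longrightarrow> X = B" ..
  then have B: "B \<subseteq> eigenvectors M A" "orthonormal_family B (\<lambda>b. b)"
    by (simp_all add: \<B>_def)
  have max: "X = B" if "X \<subseteq> eigenvectors M A" "orthonormal_family X (\<lambda>b. b)" "B \<subseteq> X" for X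
    using maxB that by (simp add: \<B>_def)
  have BM: "B \<subseteq> M" using B(1) by (auto simp: eigenvectors_def)
  \<comment> \<open>Otherwise the residual, normalised to \<open>u\<close>, is an eigenvector
    orthogonal to \<open>B\<close> and could be added to \<open>B\<close>.\<close>
  have eigen: "e = (\<Sum>\<^sub>\<infinity>b\<in>B. cinner e b *\<^sub>C b)" if e: "e \<in> eigenvectors M A" for e
  proof (rule ccontr)
    define y where "y = e - (\<Sum>\<^sub>\<infinity>b\<in>B. cinner e b *\<^sub>C b)"
    assume "e \<noteq> (\<Sum>\<^sub>\<infinity>b\<in>B. cinner e b *\<^sub>C b)"
    then have ynz: "y \<noteq> 0" by (simp add: y_def)
    have eM: "e \<in> M" using e by (simp add: eigenvectors_def)
    have yB: "cinner y b = 0" if "b \<in> B" for b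
      by (rule orthonormal_residual(2)[OF B(2) BM M eM y_def that])
    have yeig: "y \<in> eigenvectors M A"
      unfolding y_def by (rule eigenvectors_residual[OF A M B(2,1) e])
    define u where "u = inverse (complex_of_real (norm y)) *\<^sub>C y"
    have "u \<in> eigenvectors M A"
      unfolding u_def by (rule eigenvectors_scaleC[OF A M yeig])
    moreover have uu: "cinner u u = 1"
      using ynz by (simp add: cinner_self u_def norm_inverse)
    moreover have uB: "cinner u b = 0" "cinner b u = 0" if "b \<in> B" for b
      using yB[OF that] by (simp_all add: cinner_eq_0_commute[of b] u_def cinner_scaleC_left)
    ultimately have "insert u B = B"
      using B by (intro max) (auto simp: orthonormal_family_def)
    then have "u \<in> B" by auto
    then show False using uu uB[of u] by simp
  qed
  have "((\<lambda>b. cinner x b *\<^sub>C b) has_sum x) B" if x: "x \<in> M" for x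
  proof -
    define y where "y = x - (\<Sum>\<^sub>\<infinity>b\<in>B. cinner x b *\<^sub>C b)"
    note y = orthonormal_residual[OF B(2) BM M x y_def]
    \<comment> \<open>The residual of \<open>x\<close> is orthogonal to \<open>B\<close>, hence by
      \<open>eigen\<close> to every eigenvector.\<close>
    have "cinner y e = 0" if e: "e \<in> eigenvectors M A" for e
    proof -
      have "((\<lambda>b. cinner e b *\<^sub>C b) has_sum e) B"
        using has_sum_infsum[OF orthonormal_summable_on[OF B(2), of e]] by (simp flip: eigen[OF e])
      then have "((\<lambda>b. cinner y (cinner e b *\<^sub>C b)) has_sum cinner y e) B"
        by (rule has_sum_bounded_linear[OF bounded_linear_cinner_right])
      moreover have "((\<lambda>b. cinner y (cinner e b *\<^sub>C b)) has_sum 0) B"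
        using y(2) by (intro has_sum_0) (simp add: cinner_scaleC_right)
      ultimately show ?thesis using has_sum_unique by blast
    qed
    then have "y = 0" by (rule eigenvectors_totalD[OF tot y(1)])
    then show ?thesis using y(3) by simp
  qed
  then have "orthonormal_basis M B"
    using BM B(2) by (simp add: orthonormal_basis_def)
  then show ?thesis using B(1) by blast
qed

lemma orthogonal_orthonormal_basis:
  assumes "orthonormal_basis M B" "x \<in> M" "\<And>b. b \<in> B \<Longrightarrow> cinner x b = 0"
  shows "x = 0"
proof -
  have "((\<lambda>b. cinner x b *\<^sub>C b) has_sum x) B"
    using assms(1,2) by (simp add: orthonormal_basis_def)
  moreover have "((\<lambda>b. cinner x b *\<^sub>C b) has_sum 0) B"
    using assms(3) by (intro has_sum_0) simp
  ultimately show ?thesis using has_sum_unique by blast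
qed

lemma diagonalizable_iff_eigenvectors_total:
  assumes A: "selfadjoint_op M A" and M: "closed_csubspace M"
  shows "diagonalizable M A \<longleftrightarrow> eigenvectors_total M A"
proof
  assume "diagonalizable M A"
  then obtain B where B: "orthonormal_basis M B" "\<And>b. b \<in> B \<Longrightarrow> \<exists>c. A b = c *\<^sub>C b"
    by (auto simp: diagonalizable_def)
  then have "B \<subseteq> eigenvectors M A"
    by (auto simp: orthonormal_basis_def eigenvectors_def)
  then show "eigenvectors_total M A"
    using orthogonal_orthonormal_basis[OF B(1)] by (auto simp: eigenvectors_total_def)
next
  assume "eigenvectors_total M A"
  then show "diagonalizable M A"
    using ex_orthonormal_basis_eigenvectors[OF A M] A
    by (force simp: diagonalizable_def eigenvectors_def)
qed

text \<open>The vector \<open>\<psi> n\<close> is an eigenvector of \<open>T T'\<close> for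
  \<open>s n * s n\<close>, and whatever is orthogonal to all \<open>\<psi> n\<close> is killed by
  \<open>T'\<close>, so it is an eigenvector for 0. Conversely, an orthonormal basis of eigenvectors
  supplies the left singular vectors, and \<open>T'\<close> maps them to multiples of the right
  ones.\<close>

lemma S_decomposable_iff_eigenvectors_total:
  assumes T: "adjoint_pair M N T T'" and M: "closed_csubspace M" and N: "closed_csubspace N"
  shows "S_decomposable M N T \<longleftrightarrow> eigenvectors_total N (\<lambda>y. T (T' y))"
proof
  have bT: "bounded_op M N T" and bT': "bounded_op N M T'"
    and adj: "\<And>x y. x \<in> M \<Longrightarrow> y \<in> N \<Longrightarrow> cinner (T x) y = cinner x (T' y)"
    using T by (auto simp: adjoint_pair_def)
  have ext: "x = y" if "x \<in> M" "y \<in> M" "\<And>z. z \<in> M \<Longrightarrow> cinner z x = cinner z y" for x y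
  proof -
    have "cinner (x - y) (x - y) = 0"
      using that(3)[of "x - y"] that(1,2) closed_csubspaceD(6)[OF M] by (simp add: cinner_diff_right)
    then show ?thesis by simp
  qed
  {
    assume "S_decomposable M N T"
    then obtain I :: "'a set" and s :: "'a \<Rightarrow> real" and \<xi> \<psi> where
      \<xi>: "\<xi> ` I \<subseteq> M" "orthonormal_family I \<xi>" and \<psi>: "\<psi> ` I \<subseteq> N" "orthonormal_family I \<psi>"
      and sum: "\<forall>x\<in>M. ((\<lambda>n. s n *\<^sub>R cinner x (\<xi> n) *\<^sub>C \<psi> n) has_sum T x) I"
      unfolding S_decomposable_def by (elim conjE exE) (rule that, assumption+)
    have expand: "((\<lambda>n. s n *\<^sub>R (cinner x (\<xi> n) * cinner (\<psi> n) y)) has_sum cinner (T x) y) I"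
      if "x \<in> M" for x y
      using has_sum_bounded_linear[OF bounded_linear_cinner_left bspec[OF sum that], of y]
      by (simp add: cinner_scaleR_left cinner_scaleC_left)
    have T\<psi>: "cinner (T x) (\<psi> n) = s n *\<^sub>R cinner x (\<xi> n)" if "x \<in> M" "n \<in> I" for x n
    proof -
      have "((\<lambda>k. s k *\<^sub>R (cinner x (\<xi> k) * cinner (\<psi> k) (\<psi> n))) has_sum s n *\<^sub>R cinner x (\<xi> n)) I
          \<longleftrightarrow> ((\<lambda>k. s n *\<^sub>R cinner x (\<xi> n)) has_sum s n *\<^sub>R cinner x (\<xi> n)) {n}"
        using \<psi>(2) that(2) by (intro has_sum_cong_neutral) (auto simp: orthonormal_family_def)
      then have "((\<lambda>k. s k *\<^sub>R (cinner x (\<xi> k) * cinner (\<psi> k) (\<psi> n))) has_sum s n *\<^sub>R cinner x (\<xi> n)) I"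
        by (simp add: has_sum_finite_iff)
      then show ?thesis
        using expand[OF that(1), of "\<psi> n"] has_sum_unique by blast
    qed
    have T'\<psi>: "T' (\<psi> n) = s n *\<^sub>R \<xi> n" if "n \<in> I" for n
    proof (rule ext)
      show "T' (\<psi> n) \<in> M" "s n *\<^sub>R \<xi> n \<in> M"
        using that \<xi>(1) \<psi>(1) bounded_opD(1)[OF bT'] closed_csubspaceD(7)[OF M] by auto
      show "cinner z (T' (\<psi> n)) = cinner z (s n *\<^sub>R \<xi> n)" if "z \<in> M" for z
        using T\<psi>[OF that \<open>n \<in> I\<close>] adj[OF that, of "\<psi> n"] \<psi>(1) \<open>n \<in> I\<close>
        by (auto simp: cinner_scaleR_right)
    qed
    have T\<xi>: "T (\<xi> n) = s n *\<^sub>R \<psi> n" if "n \<in> I" for n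
    proof -
      have "((\<lambda>k. s k *\<^sub>R cinner (\<xi> n) (\<xi> k) *\<^sub>C \<psi> k) has_sum s n *\<^sub>R \<psi> n) I
          \<longleftrightarrow> ((\<lambda>k. s n *\<^sub>R \<psi> n) has_sum s n *\<^sub>R \<psi> n) {n}"
        using \<xi>(2) that by (intro has_sum_cong_neutral) (auto simp: orthonormal_family_def)
      then have "((\<lambda>k. s k *\<^sub>R cinner (\<xi> n) (\<xi> k) *\<^sub>C \<psi> k) has_sum s n *\<^sub>R \<psi> n) I"
        by (simp add: has_sum_finite_iff)
      then show ?thesis
        using bspec[OF sum, of "\<xi> n"] \<xi>(1) that has_sum_unique by blast
    qed
    have \<psi>_eig: "\<psi> n \<in> eigenvectors N (\<lambda>y. T (T' y))" if "n \<in> I" for n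
    proof -
      have "T (T' (\<psi> n)) = complex_of_real (s n * s n) *\<^sub>C \<psi> n"
        using bounded_opD(3)[OF bT, of "\<xi> n" "complex_of_real (s n)"] \<xi>(1) that
        by (auto simp: T'\<psi> T\<xi> scaleR_scaleC[of _ "_ :: 'a"] scaleC_scaleC)
      then show ?thesis using \<psi>(1) that by (auto simp: eigenvectors_def)
    qed
    show "eigenvectors_total N (\<lambda>y. T (T' y))"
    proof (rule eigenvectors_totalI)
      fix y assume y: "y \<in> N" "\<And>e. e \<in> eigenvectors N (\<lambda>y. T (T' y)) \<Longrightarrow> cinner y e = 0"
      have "T' y = 0"
      proof (rule ext)
        show "T' y \<in> M" "0 \<in> M" using bounded_opD(1)[OF bT' y(1)] closed_csubspaceD(2)[OF M] by auto
        show "cinner z (T' y) = cinner z 0" if "z \<in> M" for z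
        proof -
          have "((\<lambda>n. s n *\<^sub>R (cinner z (\<xi> n) * cinner (\<psi> n) y)) has_sum 0) I"
            using y(2)[OF \<psi>_eig] by (intro has_sum_0) (simp add: cinner_eq_0_commute[of "\<psi> _"])
          then have "cinner (T z) y = 0"
            using expand[OF that, of y] has_sum_unique by blast
          then show ?thesis using adj[OF that y(1)] by simp
        qed
      qed
      then have "T (T' y) = 0 *\<^sub>C y" using bounded_op_zero[OF bT M] by simp
      then show "y \<in> eigenvectors N (\<lambda>y. T (T' y))"
        using y(1) unfolding eigenvectors_def by blast
    qed
  }
  assume "eigenvectors_total N (\<lambda>y. T (T' y))"
  then obtain B where B: "orthonormal_basis N B" "B \<subseteq> eigenvectors N (\<lambda>y. T (T' y))"
    using ex_orthonormal_basis_eigenvectors[OF adjoint_pair_selfadjoint_op[OF T] N] by blast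
  have BN: "B \<subseteq> N" and Bo: "orthonormal_family B (\<lambda>b. b)"
    and Bs: "\<And>x. x \<in> N \<Longrightarrow> ((\<lambda>b. cinner x b *\<^sub>C b) has_sum x) B"
    using B(1) by (auto simp: orthonormal_basis_def)
  \<comment> \<open>The basis vectors index themselves. Those killed by \<open>T'\<close> are left
    out, since they would have singular value 0.\<close>
  define I where "I = {b\<in>B. T' b \<noteq> 0}"
  define s where "s b = norm (T' b)" for b
  define \<xi> where "\<xi> b = inverse (s b) *\<^sub>R T' b" for b
  have T'M: "T' b \<in> M" if "b \<in> B" for b using that BN bounded_opD(1)[OF bT'] by auto
  have "cinner (\<xi> b) (\<xi> b') = (if b = b' then 1 else 0)" if b: "b \<in> I" "b' \<in> I" for b b'
  proof (cases "b = b'")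
    case True
    have "norm (\<xi> b) = 1" using b by (simp add: \<xi>_def s_def I_def)
    then show ?thesis using True by (simp add: cinner_self)
  next
    case False
    obtain c where c: "T (T' b) = c *\<^sub>C b" using b B(2) by (auto simp: I_def eigenvectors_def)
    have "cinner (T' b) (T' b') = cinner (T (T' b)) b'"
      using adj[OF T'M, of b b'] b BN by (auto simp: I_def)
    also have "\<dots> = 0"
      using c b False orthonormal_familyD(2)[OF Bo, of b b'] by (simp add: I_def cinner_scaleC_left)
    finally show ?thesis using False by (simp add: \<xi>_def cinner_scaleR_left cinner_scaleR_right)
  qed
  then have \<xi>o: "orthonormal_family I \<xi>" by (simp add: orthonormal_family_def)
  have "((\<lambda>b. s b *\<^sub>R cinner x (\<xi> b) *\<^sub>C b) has_sum T x) I" if x: "x \<in> M" for x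
  proof -
    have Tb: "cinner (T x) b = cinner x (T' b)" if "b \<in> B" for b
      using adj[OF x] that BN by auto
    have "((\<lambda>b. cinner (T x) b *\<^sub>C b) has_sum T x) B"
      using Bs bounded_opD(1)[OF bT x] by blast
    \<comment> \<open>The terms outside \<open>I\<close> vanish because
      \<open>cinner (T x) b = cinner x (T' b)\<close>; inside, \<open>s b\<close> and
      \<open>inverse (s b)\<close> cancel.\<close>
    moreover have "((\<lambda>b. cinner (T x) b *\<^sub>C b) has_sum T x) B
        \<longleftrightarrow> ((\<lambda>b. s b *\<^sub>R cinner x (\<xi> b) *\<^sub>C b) has_sum T x) I"
      by (intro has_sum_cong_neutral)
        (auto simp: I_def Tb \<xi>_def s_def cinner_scaleR_right scaleC_scaleR_left)
    ultimately show ?thesis by blast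
  qed
  moreover have "\<xi> ` I \<subseteq> M"
    using T'M closed_csubspaceD(7)[OF M] by (auto simp: \<xi>_def I_def)
  moreover have "orthonormal_family I (\<lambda>b. b)" "(\<lambda>b. b) ` I \<subseteq> N"
    using Bo BN by (auto simp: orthonormal_family_def I_def)
  moreover have "\<forall>b\<in>I. s b > 0" by (simp add: s_def I_def)
  ultimately have "\<xi> ` I \<subseteq> M \<and> orthonormal_family I \<xi> \<and> (\<lambda>b. b) ` I \<subseteq> N \<and>
      orthonormal_family I (\<lambda>b. b) \<and> (\<forall>n\<in>I. s n > 0) \<and>
      (\<forall>x\<in>M. ((\<lambda>n. s n *\<^sub>R cinner x (\<xi> n) *\<^sub>C n) has_sum T x) I)"
    using \<xi>o by simp
  then show "S_decomposable M N T"
    unfolding S_decomposable_def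
    by (rule_tac conjI[OF bT], rule_tac x = I in exI, rule_tac x = s in exI, rule_tac x = \<xi> in exI,
        rule_tac x = "\<lambda>b. b" in exI)
qed

section \<open>Flows of skew-adjoint operators\<close>

text \<open>Exponentials enter the argument through the differential equation they solve, for all
  real times and within \<open>M\<close>.\<close>

definition flow :: "'a::real_normed_vector set \<Rightarrow> ('a \<Rightarrow> 'a) \<Rightarrow> (real \<Rightarrow> 'a) \<Rightarrow> bool" where
  "flow M T f \<longleftrightarrow> (\<forall>t. f t \<in> M \<and> (f has_vector_derivative T (f t)) (at t))"

lemma flowD:
  assumes "flow M T f"
  shows "f t \<in> M" and "(f has_vector_derivative T (f t)) (at t)"
  using assms by (auto simp: flow_def)

lemma flow_shift:
  assumes "flow M T f"
  shows "flow M T (\<lambda>t. f (t + s))"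
proof -
  have "((f \<circ> (\<lambda>t. t + s)) has_vector_derivative 1 *\<^sub>R T (f (t + s))) (at t)" for t
    using flowD(2)[OF assms]
    by (intro vector_diff_chain_at) (auto intro!: derivative_eq_intros)
  then show ?thesis
    using flowD(1)[OF assms] by (simp add: flow_def o_def)
qed

locale skew_operator =
  fixes M :: "'a::real_inner set" and T :: "'a \<Rightarrow> 'a"
  assumes skew: "\<And>x y. x \<in> M \<Longrightarrow> y \<in> M \<Longrightarrow> inner (T x) y = - inner x (T y)"
begin

text \<open>Skewness cancels the two terms of the product rule. So inner products of flow lines
  depend on time differences only; constancy of the norm, uniqueness and the doubling estimate all
  rest on this.\<close>

lemma flow_inner_shift:
  assumes f: "flow M T f" and g: "flow M T g"
  shows "inner (f (a + t)) (g (b + t)) = inner (f a) (g b)"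
proof -
  have "((\<lambda>t. inner (f (t + a)) (g (t + b))) has_real_derivative 0) (at t)" for t
  proof -
    have "((\<lambda>t. inner (f (t + a)) (g (t + b))) has_vector_derivative
        inner (f (t + a)) (T (g (t + b))) + inner (T (f (t + a))) (g (t + b))) (at t)"
      by (rule bounded_bilinear.has_vector_derivative[OF bounded_bilinear_inner])
        (rule flowD(2)[OF flow_shift[OF f]] flowD(2)[OF flow_shift[OF g]])+
    then show ?thesis
      using skew[of "f (t + a)" "g (t + b)"] flowD(1)[OF f] flowD(1)[OF g]
      by (simp add: has_real_derivative_iff_has_vector_derivative)
  qed
  then have "(\<lambda>t. inner (f (t + a)) (g (t + b))) t = (\<lambda>t. inner (f (t + a)) (g (t + b))) 0"
    using DERIV_isconst_all by blast
  then show ?thesis by (simp add: add.commute)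
qed

lemma flow_norm: "flow M T f \<Longrightarrow> norm (f t) = norm (f 0)"
  using flow_inner_shift[of f f 0 t 0] by (simp add: norm_eq_sqrt_inner)

text \<open>The distance of two flow lines is constant, since all four inner products in its
  expansion are.\<close>

lemma flow_unique:
  assumes f: "flow M T f" and g: "flow M T g" and "f 0 = g 0"
  shows "f t = g t"
proof -
  have "(norm (f t - g t))\<^sup>2 = (norm (f 0 - g 0))\<^sup>2"
    using flow_inner_shift[OF f f, of 0 t 0] flow_inner_shift[OF f g, of 0 t 0]
      flow_inner_shift[OF g f, of 0 t 0] flow_inner_shift[OF g g, of 0 t 0]
    by (simp add: power2_norm_eq_inner inner_diff_left inner_diff_right)
  then show ?thesis using assms(3) by simp
qed

lemma flow_displacement:
  assumes f: "flow M T f" and c: "\<And>x. x \<in> M \<Longrightarrow> norm (T x) \<le> c * norm x"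
  shows "norm (f t - f 0) \<le> c * norm (f 0) * \<bar>t\<bar>"
proof -
  have "norm (f t - f 0) \<le> (c * norm (f 0)) * norm (t - 0)"
  proof (rule differentiable_bound[where S = UNIV and f' = "\<lambda>t h. h *\<^sub>R T (f t)"])
    show "(f has_derivative (\<lambda>h. h *\<^sub>R T (f t))) (at t)" for t
      using flowD(2)[OF f] by (simp add: has_vector_derivative_def)
    show "onorm (\<lambda>h. h *\<^sub>R T (f t)) \<le> c * norm (f 0)" for t
      using c[OF flowD(1)[OF f, of t]] flow_norm[OF f, of t]
      by (simp add: onorm_scaleR_left[OF bounded_linear_ident] onorm_id)
  qed auto
  then show ?thesis by simp
qed

text \<open>The double-angle formula as an inequality. Both \<open>f t\<close> and
  \<open>f (- t)\<close> have inner product \<open>h\<close> with \<open>f 0\<close>; Cauchy-Schwarz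
  is applied to their sum, whose norm involves \<open>inner (f t) (f (- t))\<close>, that is
  \<open>inner (f (2 * t)) (f 0)\<close>. The sign assumption permits squaring.\<close>

lemma flow_inner_double:
  assumes f: "flow M T f" and "inner (f t) (f 0) \<ge> 0"
  shows "2 * (inner (f t) (f 0))\<^sup>2 \<le> (norm (f 0))\<^sup>2 * ((norm (f 0))\<^sup>2 + inner (f (2 * t)) (f 0))"
proof -
  define h where "h = inner (f t) (f 0)"
  have h': "inner (f (- t)) (f 0) = h"
    using flow_inner_shift[OF f f, of "- t" t 0] by (simp add: h_def inner_commute)
  have "inner (f t) (f (- t)) = inner (f (2 * t)) (f 0)"
    using flow_inner_shift[OF f f, of "t" t "- t"] by simp
  then have pq: "(norm (f t + f (- t)))\<^sup>2 = 2 * (norm (f 0))\<^sup>2 + 2 * inner (f (2 * t)) (f 0)"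
    using flow_norm[OF f, of t] flow_norm[OF f, of "- t"]
    by (simp add: power2_norm_eq_inner[symmetric] inner_add_left inner_add_right inner_commute
        dot_norm[of "f t" "f (- t)"])
  have "2 * h \<le> norm (f t + f (- t)) * norm (f 0)"
    using norm_cauchy_schwarz[of "f t + f (- t)" "f 0"] h' by (simp add: inner_add_left h_def)
  then have "(2 * h)\<^sup>2 \<le> (norm (f t + f (- t)) * norm (f 0))\<^sup>2"
    using assms(2) by (intro power_mono) (auto simp: h_def)
  then show ?thesis
    by (simp add: power_mult_distrib pq h_def algebra_simps)
qed

text \<open>
  By \<open>cos (2 * x) = 2 * (cos x)\<^sup>2 - 1\<close>, the previous lemma carries the bound from small times to all
  times with \<open>d * \<bar>t\<bar> \<le> pi\<close>.
\<close>

lemma flow_inner_ge_cos_aux: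
  assumes f: "flow M T f" and N: "norm (f 0) = N" "N > 0"
    and \<delta>: "\<And>s. \<bar>s\<bar> \<le> \<delta> \<Longrightarrow> N\<^sup>2 * cos (d * s) \<le> inner (f s) (f 0)"
    and d: "d > 0" and t: "\<bar>t\<bar> \<le> \<delta> * 2 ^ n" "d * \<bar>t\<bar> \<le> pi"
  shows "N\<^sup>2 * cos (d * t) \<le> inner (f t) (f 0)"
  using t
proof (induction n arbitrary: t)
  case 0
  then show ?case using \<delta> by simp
next
  case (Suc n)
  have dt: "\<bar>d * (t / 2)\<bar> \<le> pi / 2"
    using Suc.prems(2) d by (simp add: abs_mult)
  \<comment> \<open>At \<open>t / 2\<close> the cosine is nonnegative, as the doubling estimate and
    the squaring of \<open>IH\<close> require.\<close>
  then have pos: "0 \<le> cos (d * (t / 2))"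
    by (intro cos_ge_zero) auto
  have IH: "N\<^sup>2 * cos (d * (t / 2)) \<le> inner (f (t / 2)) (f 0)"
  proof (rule Suc.IH)
    have "d * \<bar>t / 2\<bar> = d * \<bar>t\<bar> / 2" by simp
    then show "d * \<bar>t / 2\<bar> \<le> pi"
      using Suc.prems(2) pi_gt_zero by linarith
  qed (use Suc.prems(1) in simp)
  have pos': "0 \<le> N\<^sup>2 * cos (d * (t / 2))"
    using pos by simp
  have "N\<^sup>2 * (N\<^sup>2 * cos (d * t)) = 2 * (N\<^sup>2 * cos (d * (t / 2)))\<^sup>2 - N\<^sup>2 * N\<^sup>2"
  proof -
    have "cos (d * t) = 2 * (cos (d * (t / 2)))\<^sup>2 - 1"
      using cos_double_cos[of "d * (t / 2)"] by simp
    then show ?thesis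
      by (simp only: power_mult_distrib right_diff_distrib) (simp add: power2_eq_square)
  qed
  also have "\<dots> \<le> 2 * (inner (f (t / 2)) (f 0))\<^sup>2 - N\<^sup>2 * N\<^sup>2"
    using power_mono[OF IH pos', of 2] by simp
  also have "\<dots> \<le> N\<^sup>2 * inner (f t) (f 0)"
    using flow_inner_double[OF f, of "t / 2"] IH pos' N by (simp add: algebra_simps)
  finally show ?case
    by (rule mult_left_le_imp_le) (use N in simp)
qed

text \<open>For small times \<open>flow_displacement\<close> keeps \<open>f s\<close> so close to
  \<open>f 0\<close> that the gap between \<open>c\<close> and \<open>d\<close> leaves room for the
  cosine. Repeated doubling reaches the given \<open>t\<close>.\<close>

lemma flow_inner_ge_cos:
  assumes f: "flow M T f" and N: "norm (f 0) = N" "N > 0"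
    and c: "\<And>x. x \<in> M \<Longrightarrow> norm (T x) \<le> c * norm x"
    and d: "c < d" "d > 0" and t: "d * \<bar>t\<bar> \<le> pi"
  shows "N\<^sup>2 * cos (d * t) \<le> inner (f t) (f 0)"
proof -
  have c0: "c \<ge> 0"
  proof -
    have "0 \<le> c * N"
      using flow_displacement[OF f c, of 1] N order_trans[OF norm_ge_zero] by fastforce
    then show ?thesis using N by (simp add: zero_le_mult_iff)
  qed
  \<comment> \<open>Near 0 the quotient \<open>sin x / x\<close> exceeds \<open>c / d\<close>, so
    \<open>sin (d * s / 2)\<close> dominates \<open>c * s / 2\<close> in absolute value.\<close>
  have "((\<lambda>x::real. sin x / x) \<longlongrightarrow> 1) (at 0)"
    by real_asymp
  moreover have "c / d < 1" using d by simp
  ultimately have "\<forall>\<^sub>F x in at (0::real). c / d < sin x / x"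
    by (rule order_tendstoD(1))
  then obtain \<epsilon> where \<epsilon>: "\<epsilon> > 0" "\<And>x::real. x \<noteq> 0 \<Longrightarrow> \<bar>x\<bar> < \<epsilon> \<Longrightarrow> c / d < sin x / x"
    by (auto simp: eventually_at)
  define \<delta> where "\<delta> = \<epsilon> / d"
  have \<delta>0: "\<delta> > 0" using \<epsilon>(1) d by (simp add: \<delta>_def)
  have "N\<^sup>2 * cos (d * s) \<le> inner (f s) (f 0)" if s: "\<bar>s\<bar> \<le> \<delta>" for s
  proof (cases "s = 0")
    case True
    then show ?thesis using N by (simp add: power2_norm_eq_inner[symmetric])
  next
    case False
    \<comment> \<open>With half the angle, \<open>cos (d * s)\<close> is
      \<open>1 - 2 * (sin x)^2\<close>, while the displacement bound reads
      \<open>1 - 2 * (c * s / 2)^2\<close>, up to the factor \<open>N^2\<close>.\<close>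
    define x where "x = d * s / 2"
    have x: "x \<noteq> 0" "\<bar>x\<bar> < \<epsilon>"
      using False d s \<epsilon>(1) by (auto simp: x_def \<delta>_def abs_mult field_simps)
    have "0 \<le> c / d" using c0 d by simp
    then have "(c / d)\<^sup>2 \<le> (sin x / x)\<^sup>2"
      using \<epsilon>(2)[OF x] by (intro power_mono) auto
    then have "(c / d * x)\<^sup>2 \<le> (sin x)\<^sup>2"
      using x(1) by (simp add: power_mult_distrib power_divide pos_le_divide_eq)
    moreover have "c / d * x = c * s / 2"
      using d by (simp add: x_def)
    ultimately have "(c * s / 2)\<^sup>2 \<le> (sin x)\<^sup>2"
      by (simp only:)
    then have sin: "N\<^sup>2 * (c * s)\<^sup>2 \<le> N\<^sup>2 * (4 * (sin x)\<^sup>2)"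
      by (intro mult_left_mono) (simp_all add: power_divide)
    have "(norm (f s - f 0))\<^sup>2 \<le> (c * N * \<bar>s\<bar>)\<^sup>2"
      using flow_displacement[OF f c, of s] N by (intro power_mono) auto
    then have "2 * N\<^sup>2 - 2 * inner (f s) (f 0) \<le> N\<^sup>2 * (c * s)\<^sup>2"
      using flow_norm[OF f, of s] N dot_norm_neg[of "f s" "f 0"]
      by (simp add: power_mult_distrib mult_ac)
    moreover have "cos (d * s) = 1 - 2 * (sin x)\<^sup>2"
      using cos_double_sin[of x] by (simp add: x_def)
    then have "N\<^sup>2 * cos (d * s) = N\<^sup>2 - 2 * (N\<^sup>2 * (sin x)\<^sup>2)"
      by (simp only: right_diff_distrib mult.left_commute mult_1_right)
    ultimately show ?thesis using sin by simp
  qed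
  moreover obtain n where "\<bar>t\<bar> / \<delta> < 2 ^ n"
    using real_arch_pow[of 2] by auto
  then have "\<bar>t\<bar> \<le> \<delta> * 2 ^ n"
    using \<delta>0 by (simp add: field_simps)
  ultimately show ?thesis
    using flow_inner_ge_cos_aux[OF f N _ d(2) _ t] by blast
qed

text \<open>
  The velocities along a closed flow line average to zero.  But they form a flow line themselves,
  so the velocity at time \<open>t\<close> makes an angle of at most \<open>c * \<bar>t\<bar>\<close> with the one at time 0, and
  the mean of \<open>cos (c * t)\<close> over \<open>[- 1, 1]\<close> is positive if \<open>c < pi\<close>.
\<close>

lemma closed_flow_stationary:
  assumes f: "flow M T f" and g: "flow M T (\<lambda>t. T (f t))" and closed: "f 1 = f (- 1)"
    and c: "\<And>x. x \<in> M \<Longrightarrow> norm (T x) \<le> c * norm x" and "c < pi"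
  shows "T (f 0) = 0"
proof (rule ccontr)
  define N where "N = norm (T (f 0))"
  assume "T (f 0) \<noteq> 0"
  then have N: "N > 0" by (simp add: N_def)
  \<comment> \<open>The midpoint of \<open>max c 0\<close> and \<open>pi\<close> is positive and
    strictly between \<open>c\<close> and \<open>pi\<close>.\<close>
  define d where "d = (max c 0 + pi) / 2"
  have d: "c < d" "0 < d" "d < pi"
    using \<open>c < pi\<close> pi_gt_zero by (auto simp: d_def max_def field_simps)
  have lower: "N\<^sup>2 * cos (d * t) \<le> inner (T (f t)) (T (f 0))" if "\<bar>t\<bar> \<le> 1" for t
  proof -
    have "d * \<bar>t\<bar> \<le> d"
      using that d(2) by (intro mult_left_le) auto
    then show ?thesis
      using flow_inner_ge_cos[OF g _ N c d(1,2), of t] d(3) by (simp add: N_def)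
  qed
  \<comment> \<open>The component of the curve along its velocity at time 0, minus an antiderivative
    of the lower bound for its derivative, is nondecreasing. As the curve is closed, the first parts
    cancel at the end points, which leaves \<open>sin d \<le> 0\<close> against
    \<open>0 < d < pi\<close>.\<close>
  define \<psi> where "\<psi> t = inner (f t) (T (f 0)) - N\<^sup>2 * sin (d * t) / d" for t
  have "\<psi> (- 1) \<le> \<psi> 1"
  proof (rule DERIV_nonneg_imp_nondecreasing[where f = \<psi>])
    fix t :: real assume t: "- 1 \<le> t" "t \<le> 1"
    have "((\<lambda>t. inner (f t) (T (f 0))) has_real_derivative inner (T (f t)) (T (f 0))) (at t)"
      using bounded_linear.has_vector_derivative[OF bounded_linear_inner_left flowD(2)[OF f]]
      by (simp add: has_real_derivative_iff_has_vector_derivative)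
    then have "(\<psi> has_real_derivative (inner (T (f t)) (T (f 0)) - N\<^sup>2 * cos (d * t))) (at t)"
      unfolding \<psi>_def using d(2) by (auto intro!: derivative_eq_intros)
    then show "\<exists>y. (\<psi> has_real_derivative y) (at t) \<and> 0 \<le> y"
      using lower[of t] t by (intro exI conjI) auto
  qed simp
  then have "N\<^sup>2 * sin d / d \<le> 0"
    by (simp add: \<psi>_def closed)
  moreover have "sin d > 0" using d by (intro sin_gt_zero) auto
  ultimately show False using N d by (simp add: divide_le_0_iff mult_le_0_iff)
qed

end

section \<open>Exponentials of self-adjoint operators\<close>

text \<open>A summable majorant; \<open>R\<close> in place of \<open>\<bar>t\<bar>\<close> makes it
  uniform on \<open>{- R..R}\<close> for the Weierstrass test.\<close>

lemma exp_series_bound: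
  fixes y :: "nat \<Rightarrow> 'a::real_normed_vector"
  assumes "\<And>n. norm (y n) \<le> C * K ^ n" and "\<bar>t\<bar> \<le> R"
  shows "norm ((t ^ n / fact n) *\<^sub>R y n) \<le> C * (inverse (fact n) * (R * K) ^ n)"
proof -
  have "0 \<le> C * K ^ n"
    using assms(1)[of n] norm_ge_zero order_trans by blast
  then have "\<bar>t\<bar> ^ n * norm (y n) \<le> R ^ n * (C * K ^ n)"
    using assms by (intro mult_mono power_mono) auto
  then have "\<bar>t\<bar> ^ n * norm (y n) * inverse (fact n) \<le> R ^ n * (C * K ^ n) * inverse (fact n)"
    by (rule mult_right_mono) simp
  then show ?thesis
    by (simp add: power_abs abs_mult power_mult_distrib field_simps)
qed

lemma exp_series_summable:
  fixes y :: "nat \<Rightarrow> 'a::banach"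
  assumes "\<And>n. norm (y n) \<le> C * K ^ n"
  shows "summable (\<lambda>n. (t ^ n / fact n) *\<^sub>R y n)"
  using exp_series_bound[OF assms order.refl]
  by (rule summable_comparison_test'[OF summable_mult[OF summable_exp]])

text \<open>Termwise differentiation: the derived series has the same shape with \<open>y\<close>
  shifted by one, so the same majorants apply. For \<open>y n = (iX ^^ n) x\<close> the shift is one
  application of the generator.\<close>

lemma exp_series_has_vector_derivative:
  fixes y :: "nat \<Rightarrow> 'a::banach"
  assumes y: "\<And>n. norm (y n) \<le> C * K ^ n"
  shows "((\<lambda>t. \<Sum>n. (t ^ n / fact n) *\<^sub>R y n) has_vector_derivative
      (\<Sum>n. (t ^ n / fact n) *\<^sub>R y (Suc n))) (at t)"
proof -
  let ?f = "\<lambda>n t. (t ^ n / fact n) *\<^sub>R y n"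
  let ?f' = "\<lambda>n t. (t ^ n / fact n) *\<^sub>R y (Suc n)"
  define R where "R = \<bar>t\<bar> + 1"
  have y': "norm (y (Suc n)) \<le> (C * K) * K ^ n" for n
    using y[of "Suc n"] by (simp add: mult.assoc)
  have "uniform_limit {- R..R} (\<lambda>n t. \<Sum>i<n. ?f' i t) (\<lambda>t. \<Sum>i. ?f' i t) sequentially"
    using exp_series_bound[OF y', of _ R]
    by (intro Weierstrass_m_test[where M = "\<lambda>n. C * K * (inverse (fact n) * (R * K) ^ n)"]
        summable_mult summable_exp) auto
  then have ev: "\<forall>\<^sub>F n in sequentially. \<forall>t\<in>{- R..R}. dist (\<Sum>i<n. ?f' i t) (\<Sum>i. ?f' i t) < e"
    if "e > 0" for e
    using that by (auto simp: uniform_limit_iff)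
  have "\<exists>g. \<forall>t\<in>{- R..R}. (\<lambda>n. ?f n t) sums g t \<and>
      (g has_derivative (\<lambda>h. h *\<^sub>R (\<Sum>n. ?f' n t))) (at t within {- R..R})"
  proof (rule has_derivative_series)
    show "convex {- R..R}" by simp
    show "(?f n has_derivative (\<lambda>h. h *\<^sub>R (real n * t ^ (n - 1) / fact n) *\<^sub>R y n)) (at t within {- R..R})"
      for n t
      by (auto intro!: derivative_eq_intros simp: fun_eq_iff)
    show "(\<lambda>n. ?f n 0) sums (\<Sum>n. ?f n 0)"
      using exp_series_summable[OF y] by (rule summable_sums)
    show "0 \<in> {- R..R}" by (simp add: R_def)
    fix e :: real assume "e > 0"
    \<comment> \<open>The term of index 0 has derivative zero, so the first \<open>n\<close> derived
      terms are the first \<open>n - 1\<close> terms of the shifted series; \<open>n > 0\<close>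
      rules out truncated subtraction.\<close>
    from ev[OF this] have "\<forall>\<^sub>F n in sequentially. \<forall>t\<in>{- R..R}.
        dist (\<Sum>i<n - 1. ?f' i t) (\<Sum>i. ?f' i t) < e"
      by (rule eventually_compose_filterlim[where f = "\<lambda>n. n - 1"]) real_asymp
    moreover have "\<forall>\<^sub>F n in sequentially. n > (0::nat)"
      by (rule eventually_gt_at_top)
    ultimately show "\<forall>\<^sub>F n in sequentially. \<forall>t\<in>{- R..R}. \<forall>h. norm ((\<Sum>i<n.
        h *\<^sub>R (real i * t ^ (i - 1) / fact i) *\<^sub>R y i) - h *\<^sub>R (\<Sum>n. ?f' n t)) \<le> e * norm h"
    proof eventually_elim
      case (elim n)
      show ?case
      proof (intro ballI allI)
        fix t h assume t: "t \<in> {- R..R}"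
        obtain m where n: "n = Suc m" using elim(2) gr0_implies_Suc by blast
        have "(\<Sum>i<n. h *\<^sub>R (real i * t ^ (i - 1) / fact i) *\<^sub>R y i)
            = (\<Sum>i<m. h *\<^sub>R (real (Suc i) * t ^ i / fact (Suc i)) *\<^sub>R y (Suc i))"
          unfolding n sum.lessThan_Suc_shift by simp
        also have "\<dots> = (\<Sum>i<m. h *\<^sub>R ?f' i t)"
          by (intro sum.cong) auto
        also have "\<dots> = h *\<^sub>R (\<Sum>i<m. ?f' i t)"
          by (simp add: scaleR_right.sum)
        finally have "norm ((\<Sum>i<n. h *\<^sub>R (real i * t ^ (i - 1) / fact i) *\<^sub>R y i) - h *\<^sub>R (\<Sum>n. ?f' n t))
            = \<bar>h\<bar> * dist (\<Sum>i<m. ?f' i t) (\<Sum>n. ?f' n t)"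
          by (simp add: dist_norm flip: scaleR_diff_right)
        also have "\<dots> \<le> \<bar>h\<bar> * e"
          using elim(1) t n by (intro mult_left_mono) (auto intro: less_imp_le)
        finally show "norm ((\<Sum>i<n. h *\<^sub>R (real i * t ^ (i - 1) / fact i) *\<^sub>R y i) - h *\<^sub>R (\<Sum>n. ?f' n t))
            \<le> e * norm h"
          by (simp add: mult.commute)
      qed
    qed
  qed
  then obtain g where gR: "\<forall>t\<in>{- R..R}. (\<lambda>n. ?f n t) sums g t \<and>
      (g has_derivative (\<lambda>h. h *\<^sub>R (\<Sum>n. ?f' n t))) (at t within {- R..R})" ..
  have g: "(\<lambda>n. ?f n t) sums g t" if "t \<in> {- R..R}" for t
    using bspec[OF gR that] by (rule conjunct1)
  \<comment> \<open>As \<open>R\<close> is \<open>\<bar>t\<bar> + 1\<close>, the point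
    \<open>t\<close> is interior and the derivative within the interval is the full one.\<close>
  have t: "t \<in> {- R<..<R}" by (auto simp: R_def)
  have "(g has_derivative (\<lambda>h. h *\<^sub>R (\<Sum>n. ?f' n t))) (at t within {- R<..<R})"
  proof (rule has_derivative_subset)
    have "t \<in> {- R..R}" using t by simp
    from bspec[OF gR this] show "(g has_derivative (\<lambda>h. h *\<^sub>R (\<Sum>n. ?f' n t))) (at t within {- R..R})"
      by (rule conjunct2)
  qed auto
  then have "(g has_vector_derivative (\<Sum>n. ?f' n t)) (at t)"
    unfolding has_vector_derivative_def by (simp only: at_within_open[OF t open_greaterThanLessThan])
  then show ?thesis
    by (rule has_vector_derivative_transform_within_open[where S = "{- R<..<R}"])
      (use g t in \<open>auto simp: sums_iff\<close>)
qed

locale bounded_selfadjoint =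
  fixes M :: "'a::complex_hilbert set" and X :: "'a \<Rightarrow> 'a"
  assumes M: "closed_csubspace M" and X: "selfadjoint_op M X"
begin

text \<open>This is \<open>exp (i t X)\<close>. With the scalar inside, \<open>U 1\<close> and
  \<open>U (- 1)\<close> are the two exponentials of \<open>geodesic_exponent\<close>.\<close>

definition U :: "real \<Rightarrow> 'a \<Rightarrow> 'a" where
  "U t = op_exp (\<lambda>y. (complex_of_real t * \<i>) *\<^sub>C X y)"

abbreviation iX :: "'a \<Rightarrow> 'a" where
  "iX y \<equiv> \<i> *\<^sub>C X y"

lemma X_in: "x \<in> M \<Longrightarrow> X x \<in> M"
  and X_add: "x \<in> M \<Longrightarrow> y \<in> M \<Longrightarrow> X (x + y) = X x + X y"
  and X_scaleC: "x \<in> M \<Longrightarrow> X (c *\<^sub>C x) = c *\<^sub>C X x"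
  and X_diff: "x \<in> M \<Longrightarrow> y \<in> M \<Longrightarrow> X (x - y) = X x - X y"
  and X_adj: "x \<in> M \<Longrightarrow> y \<in> M \<Longrightarrow> cinner (X x) y = cinner x (X y)"
  using selfadjoint_opD[OF X] bounded_opD[OF selfadjoint_opD(1)[OF X]]
    bounded_op_diff[OF selfadjoint_opD(1)[OF X] M] by auto

lemma iX_in: "x \<in> M \<Longrightarrow> iX x \<in> M"
  using X_in closed_csubspaceD(4)[OF M] by blast

lemma iX_adj: "x \<in> M \<Longrightarrow> y \<in> M \<Longrightarrow> cinner (iX x) y = - cinner x (iX y)"
  using X_adj by (simp add: cinner_scaleC_left cinner_scaleC_right)

lemma iX_power_in: "x \<in> M \<Longrightarrow> (iX ^^ n) x \<in> M"
  by (induction n) (auto simp: iX_in)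

lemma ex_iX_power_bound: "\<exists>K. \<forall>x\<in>M. \<forall>n. norm ((iX ^^ n) x) \<le> norm x * K ^ n"
proof -
  obtain K where K: "\<And>x. x \<in> M \<Longrightarrow> norm (X x) \<le> K * norm x"
    using bounded_opD(5)[OF selfadjoint_opD(1)[OF X]] by blast
  have "norm ((iX ^^ n) x) \<le> norm x * \<bar>K\<bar> ^ n" if "x \<in> M" for x n
  proof (induction n)
    case (Suc n)
    have "norm ((iX ^^ Suc n) x) \<le> K * norm ((iX ^^ n) x)"
      using K[OF iX_power_in[OF that, of n]] by simp
    also have "\<dots> \<le> \<bar>K\<bar> * norm ((iX ^^ n) x)"
      by (intro mult_right_mono) auto
    also have "\<dots> \<le> \<bar>K\<bar> * (norm x * \<bar>K\<bar> ^ n)"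
      using Suc by (intro mult_left_mono) auto
    finally show ?case by (simp add: mult_ac)
  qed simp
  then show ?thesis by blast
qed

lemma U_eq:
  assumes x: "x \<in> M"
  shows "U t x = (\<Sum>n. (t ^ n / fact n) *\<^sub>R (iX ^^ n) x)"
proof -
  have "((\<lambda>y. (complex_of_real t * \<i>) *\<^sub>C X y) ^^ n) x = t ^ n *\<^sub>R (iX ^^ n) x" for n
  proof (induction n)
    case (Suc n)
    have "((\<lambda>y. (complex_of_real t * \<i>) *\<^sub>C X y) ^^ Suc n) x
        = (complex_of_real t * \<i>) *\<^sub>C X (complex_of_real (t ^ n) *\<^sub>C (iX ^^ n) x)"
      by (simp add: Suc scaleR_scaleC[of _ "_ :: 'a"])
    also have "\<dots> = (complex_of_real t * \<i>) *\<^sub>C complex_of_real (t ^ n) *\<^sub>C X ((iX ^^ n) x)"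
      by (simp only: X_scaleC[OF iX_power_in[OF x]])
    also have "\<dots> = t ^ Suc n *\<^sub>R (iX ^^ Suc n) x"
      by (simp add: scaleR_scaleC[of _ "_ :: 'a"] scaleC_scaleC mult_ac)
    finally show ?case .
  qed simp
  then show ?thesis
    by (simp add: U_def op_exp_def divide_inverse mult.commute)
qed

lemma U_sums: "x \<in> M \<Longrightarrow> (\<lambda>n. (t ^ n / fact n) *\<^sub>R (iX ^^ n) x) sums U t x"
  using ex_iX_power_bound exp_series_summable[of "\<lambda>n. (iX ^^ n) x" "norm x"]
  by (metis (no_types, lifting) U_eq summable_sums)

lemma U_in:
  assumes x: "x \<in> M"
  shows "U t x \<in> M"
proof (rule closed_sequentially[OF closed_csubspaceD(1)[OF M]])
  show "(\<lambda>k. \<Sum>n<k. (t ^ n / fact n) *\<^sub>R (iX ^^ n) x) \<longlonglongrightarrow> U t x"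
    using U_sums[OF x, of t] by (simp add: sums_def)
  show "(\<Sum>n<k. (t ^ n / fact n) *\<^sub>R (iX ^^ n) x) \<in> M" for k
    using iX_power_in[OF x] by (intro closed_csubspaceD(7,8)[OF M])
qed

lemma U_0 [simp]:
  assumes x: "x \<in> M"
  shows "U 0 x = x"
proof -
  have "U 0 x = (\<Sum>n\<in>{0}. (0 ^ n / fact n) *\<^sub>R (iX ^^ n) x)"
    unfolding U_eq[OF x] by (intro suminf_finite) auto
  then show ?thesis by simp
qed

lemma in_M_eqI:
  assumes "x \<in> M" "y \<in> M" "\<And>z. z \<in> M \<Longrightarrow> cinner x z = cinner y z"
  shows "x = y"
proof -
  have "cinner (x - y) (x - y) = 0"
    using assms(3)[of "x - y"] assms(1,2) closed_csubspaceD(6)[OF M] by (simp add: cinner_diff_left)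
  then show ?thesis by simp
qed

text \<open>\<open>X\<close> commutes with each power of \<open>iX\<close>. Moving \<open>X\<close>
  onto a test vector \<open>z\<close> transfers this to the sum term by term.\<close>

lemma X_U:
  assumes x: "x \<in> M"
  shows "X (U t x) = U t (X x)"
proof (rule in_M_eqI)
  show "X (U t x) \<in> M" "U t (X x) \<in> M"
    using x by (auto intro: X_in U_in)
  have X_iX_power: "X ((iX ^^ n) x) = (iX ^^ n) (X x)" for n
  proof (induction n)
    case (Suc n)
    then show ?case using X_scaleC[OF X_in[OF iX_power_in[OF x, of n]]] by simp
  qed simp
  fix z assume z: "z \<in> M"
  have "(\<lambda>n. cinner ((t ^ n / fact n) *\<^sub>R (iX ^^ n) x) (X z)) sums cinner (U t x) (X z)"
    by (rule bounded_linear.sums[OF bounded_linear_cinner_left U_sums[OF x]])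
  moreover have "(\<lambda>n. cinner ((t ^ n / fact n) *\<^sub>R (iX ^^ n) (X x)) z) sums cinner (U t (X x)) z"
    by (rule bounded_linear.sums[OF bounded_linear_cinner_left U_sums[OF X_in[OF x]]])
  moreover have "cinner ((t ^ n / fact n) *\<^sub>R (iX ^^ n) x) (X z)
      = cinner ((t ^ n / fact n) *\<^sub>R (iX ^^ n) (X x)) z" for n
    using X_adj[OF iX_power_in[OF x] z, of n] X_iX_power[of n] by (simp add: cinner_scaleR_left)
  ultimately have "cinner (U t x) (X z) = cinner (U t (X x)) z"
    by (simp add: sums_iff)
  then show "cinner (X (U t x)) z = cinner (U t (X x)) z"
    using X_adj[OF U_in[OF x] z] by simp
qed

lemma U_scaleC:
  assumes x: "x \<in> M"
  shows "U t (c *\<^sub>C x) = c *\<^sub>C U t x"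
proof -
  have "(iX ^^ n) (c *\<^sub>C x) = c *\<^sub>C (iX ^^ n) x" for n
  proof (induction n)
    case (Suc n)
    then show ?case
      using X_scaleC[OF iX_power_in[OF x, of n]] by (simp add: scaleC_scaleC mult.commute)
  qed simp
  then have "(\<lambda>n. c *\<^sub>C (t ^ n / fact n) *\<^sub>R (iX ^^ n) x) sums U t (c *\<^sub>C x)"
    using U_sums[OF closed_csubspaceD(4)[OF M x], of t c] by (simp add: scaleC_scaleR_right)
  then show ?thesis
    using bounded_linear.sums[OF bounded_linear_scaleC_right U_sums[OF x, of t], of c] sums_unique2
    by blast
qed

lemma U_add:
  assumes x: "x \<in> M" and y: "y \<in> M"
  shows "U t (x + y) = U t x + U t y"
proof -
  have "(iX ^^ n) (x + y) = (iX ^^ n) x + (iX ^^ n) y" for n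
  proof (induction n)
    case (Suc n)
    then show ?case
      using X_add[OF iX_power_in[OF x, of n] iX_power_in[OF y, of n]] by (simp add: scaleC_add_right)
  qed simp
  then have "(\<lambda>n. (t ^ n / fact n) *\<^sub>R (iX ^^ n) x + (t ^ n / fact n) *\<^sub>R (iX ^^ n) y) sums U t (x + y)"
    using U_sums[OF closed_csubspaceD(3)[OF M x y], of t] by (simp add: scaleR_add_right)
  then show ?thesis
    using sums_add[OF U_sums[OF x, of t] U_sums[OF y, of t]] sums_unique2 by blast
qed

lemma U_diff: "x \<in> M \<Longrightarrow> y \<in> M \<Longrightarrow> U t (x - y) = U t x - U t y"
  using U_add[of x "(- 1) *\<^sub>C y" t] U_scaleC[of y t "- 1"] closed_csubspaceD(5)[OF M, of y] by simp

lemma U_has_vector_derivative: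
  assumes x: "x \<in> M"
  shows "((\<lambda>t. U t x) has_vector_derivative iX (U t x)) (at t)"
proof -
  obtain K where "\<And>n. norm ((iX ^^ n) x) \<le> norm x * K ^ n"
    using ex_iX_power_bound x by blast
  then have "((\<lambda>t. U t x) has_vector_derivative (\<Sum>n. (t ^ n / fact n) *\<^sub>R (iX ^^ Suc n) x)) (at t)"
    unfolding U_eq[OF x] by (rule exp_series_has_vector_derivative)
  also have "(\<Sum>n. (t ^ n / fact n) *\<^sub>R (iX ^^ Suc n) x) = U t (iX x)"
    by (simp only: U_eq[OF iX_in[OF x]] funpow_Suc_right o_def)
  also have "\<dots> = iX (U t x)"
    using U_scaleC[OF X_in[OF x]] X_U[OF x] by simp
  finally show ?thesis .
qed

text \<open>The generator \<open>i (X - a)\<close>: on \<open>M\<close>, eigenvectors of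
  \<open>X\<close> for \<open>a\<close> are its zeros, that is the stationary points of its flow.
  Its flow lines are the curves \<open>modulated a x\<close>.\<close>

definition iXsub :: "real \<Rightarrow> 'a \<Rightarrow> 'a" where
  "iXsub a x = \<i> *\<^sub>C (X x - complex_of_real a *\<^sub>C x)"

definition modulated :: "real \<Rightarrow> 'a \<Rightarrow> real \<Rightarrow> 'a" where
  "modulated a x t = cis (- (t * a)) *\<^sub>C U t x"

lemma skew_operator_iXsub: "skew_operator M (iXsub a)"
proof
  fix x y assume "x \<in> M" "y \<in> M"
  then have "cinner (iXsub a x) y = - cinner x (iXsub a y)"
    using X_adj by (simp add: iXsub_def cinner_scaleC_left cinner_scaleC_right cinner_diff_left
        cinner_diff_right right_diff_distrib)
  then show "inner (iXsub a x) y = - inner x (iXsub a y)"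
    by (simp add: inner_eq_Re_cinner)
qed

lemma flow_modulated:
  assumes x: "x \<in> M"
  shows "flow M (iXsub a) (modulated a x)"
  unfolding flow_def
proof (intro allI conjI)
  fix t
  show "modulated a x t \<in> M"
    using U_in[OF x] closed_csubspaceD(4)[OF M] by (simp add: modulated_def)
  have cis: "cis (- (t * a)) = exp (t *\<^sub>R (- (\<i> * complex_of_real a)))" for t
    by (simp add: cis_conv_exp scaleR_conv_of_real mult_ac)
  have "(modulated a x has_vector_derivative
      cis (- (t * a)) *\<^sub>C iX (U t x) + (cis (- (t * a)) * (- (\<i> * complex_of_real a))) *\<^sub>C U t x) (at t)"
    unfolding modulated_def cis
    by (intro bounded_bilinear.has_vector_derivative[OF bounded_bilinear_scaleC]
        exp_scaleR_has_vector_derivative_right U_has_vector_derivative[OF x])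
  also have "cis (- (t * a)) *\<^sub>C iX (U t x) + (cis (- (t * a)) * (- (\<i> * complex_of_real a))) *\<^sub>C U t x
      = iXsub a (modulated a x t)"
    using X_scaleC[OF U_in[OF x]]
    by (simp add: iXsub_def modulated_def scaleC_scaleC scaleC_diff_right mult_ac)
  finally show "(modulated a x has_vector_derivative iXsub a (modulated a x t)) (at t)" .
qed

lemma flow_U: "x \<in> M \<Longrightarrow> flow M iX (\<lambda>t. U t x)"
  using U_in U_has_vector_derivative by (simp add: flow_def)

lemma skew_operator_iX: "skew_operator M iX"
  using iX_adj by unfold_locales (simp add: inner_eq_Re_cinner)

lemmas flow_iX_unique = skew_operator.flow_unique[OF skew_operator_iX]

text \<open>Both sides, as functions of \<open>s\<close>, are flow lines that start at
  \<open>U t x\<close>.\<close>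

lemma U_U:
  assumes x: "x \<in> M"
  shows "U s (U t x) = U (s + t) x"
proof -
  have "(\<lambda>s. U s (U t x)) s = (\<lambda>s. U (s + t) x) s"
    by (rule flow_iX_unique[OF flow_U[OF U_in[OF x]] flow_shift[OF flow_U[OF x]]])
      (simp add: U_in[OF x])
  then show ?thesis by simp
qed

text \<open>The constant curve \<open>x\<close> and \<open>modulated a x\<close> are flow lines of
  \<open>iXsub a\<close> with the same start.\<close>

lemma U_eigenvector:
  assumes x: "x \<in> M" and ev: "X x = complex_of_real a *\<^sub>C x"
  shows "U t x = cis (t * a) *\<^sub>C x"
proof -
  have "flow M (iXsub a) (\<lambda>t. x)"
    using x ev by (auto simp: flow_def iXsub_def intro: derivative_eq_intros)
  then have "modulated a x t = (\<lambda>t. x) t"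
    by (rule skew_operator.flow_unique[OF skew_operator_iXsub flow_modulated[OF x]])
      (simp add: modulated_def x)
  then have "cis (t * a) *\<^sub>C cis (- (t * a)) *\<^sub>C U t x = cis (t * a) *\<^sub>C x"
    by (simp add: modulated_def)
  then show ?thesis by (simp add: scaleC_scaleC cis_mult)
qed

text \<open>The equation for \<open>U 2\<close> says that \<open>modulated a x\<close> agrees at
  times -1 and 1. Its generator is bounded by \<open>pi / 2 + \<bar>a\<bar> < pi\<close>, so
  \<open>closed_flow_stationary\<close> makes the velocity at time 0 vanish. The strict bound on
  \<open>a\<close> matters: \<open>cis (2 * a)\<close> cannot tell \<open>pi / 2\<close> from
  \<open>- pi / 2\<close>.\<close>

lemma eigenvector_X_of_U_2:
  assumes x: "x \<in> M" and ev: "U 2 x = cis (2 * a) *\<^sub>C x" and a: "\<bar>a\<bar> < pi / 2"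
    and bound: "\<And>x. x \<in> M \<Longrightarrow> norm (X x) \<le> pi / 2 * norm x"
  shows "X x = complex_of_real a *\<^sub>C x"
proof -
  define w where "w = iXsub a x"
  have wM: "w \<in> M"
    using x closed_csubspaceD(4,6)[OF M] X_in by (simp add: w_def iXsub_def)
  \<comment> \<open>Since \<open>X\<close> commutes with \<open>U t\<close>, the velocities of the
    curve through \<open>x\<close> form the curve through \<open>w\<close>, again a flow
    line.\<close>
  have "iXsub a (modulated a x t) = modulated a w t" for t
    using x X_in X_U[OF x] X_scaleC[OF U_in[OF x]] closed_csubspaceD(4,6)[OF M]
    by (simp add: iXsub_def modulated_def w_def U_scaleC U_diff scaleC_scaleC scaleC_diff_right mult_ac)
  then have g: "flow M (iXsub a) (\<lambda>t. iXsub a (modulated a x t))"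
    using flow_modulated[OF wM, of a] by (simp add: fun_eq_iff)
  have "U 1 x = U (- 1) (cis (2 * a) *\<^sub>C x)"
    using U_U[OF x, of "- 1" 2] ev by simp
  then have "U 1 x = cis (2 * a) *\<^sub>C U (- 1) x"
    using U_scaleC[OF x] by simp
  then have closed: "modulated a x 1 = modulated a x (- 1)"
    by (simp add: modulated_def scaleC_scaleC cis_mult)
  have "norm (iXsub a x) \<le> (pi / 2 + \<bar>a\<bar>) * norm x" if "x \<in> M" for x
  proof -
    have "norm (iXsub a x) \<le> norm (X x) + \<bar>a\<bar> * norm x"
      using norm_triangle_ineq4[of "X x" "complex_of_real a *\<^sub>C x"] by (simp add: iXsub_def)
    then show ?thesis using bound[OF that] by (simp add: algebra_simps)
  qed
  then have "iXsub a (modulated a x 0) = 0"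
    using a by (intro skew_operator.closed_flow_stationary[OF skew_operator_iXsub
          flow_modulated[OF x] g closed, of "pi / 2 + \<bar>a\<bar>"]) auto
  then show ?thesis
    using x by (simp add: modulated_def iXsub_def)
qed

end

section \<open>The exponent of the geodesic and the product of the projections\<close>

locale geodesic = bounded_selfadjoint M X
  for M :: "'a::complex_hilbert set" and X :: "'a \<Rightarrow> 'a" +
  fixes P Q :: "'a \<Rightarrow> 'a"
  assumes P: "orthogonal_projection UNIV P" and Q: "orthogonal_projection UNIV Q"
    and M_eq: "M = ortho_complement (nullspace_on UNIV (\<lambda>x. P x + Q x - x))"
    and exponent: "geodesic_exponent M P Q X"
begin

lemma bounded_op_P: "bounded_op UNIV UNIV P" and bounded_op_Q: "bounded_op UNIV UNIV Q"
  using P Q selfadjoint_opD(1) by (auto simp: orthogonal_projection_def)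

lemma P_idem [simp]: "P (P x) = P x" and Q_idem [simp]: "Q (Q x) = Q x"
  using P Q by (auto simp: orthogonal_projection_def)

lemma P_adj: "cinner (P x) y = cinner x (P y)" and Q_adj: "cinner (Q x) y = cinner x (Q y)"
  using P Q selfadjoint_opD(3)[of UNIV P x y] selfadjoint_opD(3)[of UNIV Q x y]
  by (simp_all add: orthogonal_projection_def)

lemma P_add: "P (x + y) = P x + P y" and P_scaleC: "P (c *\<^sub>C x) = c *\<^sub>C P x"
  using bounded_opD(2,3)[OF bounded_op_P] by auto

lemma P_diff: "P (x - y) = P x - P y" and Q_diff: "Q (x - y) = Q x - Q y"
  using bounded_op_diff[OF bounded_op_P] bounded_op_diff[OF bounded_op_Q] by auto

lemma P_0 [simp]: "P 0 = 0" and Q_0 [simp]: "Q 0 = 0"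
  using bounded_op_zero[OF bounded_op_P] bounded_op_zero[OF bounded_op_Q] by auto

abbreviation K :: "'a set" where
  "K \<equiv> nullspace_on UNIV (\<lambda>x. P x + Q x - x)"

text \<open>On \<open>K\<close> the projection \<open>Q\<close> agrees with \<open>1 - P\<close>;
  applying \<open>Q\<close> once more gives the claim. So \<open>K\<close> lies in the kernel of
  \<open>P Q P\<close>, which forces eigenvectors for nonzero eigenvalues into
  \<open>M\<close>.\<close>

lemma QP_K:
  assumes "k \<in> K"
  shows "Q (P k) = 0"
proof -
  have "Q k = k - P k" using assms by (simp add: nullspace_on_def algebra_simps)
  then have "Q (Q k) = Q k - Q (P k)" by (metis Q_diff)
  then show ?thesis by simp
qed

lemma P_K: "k \<in> K \<Longrightarrow> P k \<in> K"
  using QP_K[of k] by (simp add: nullspace_on_def)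

lemma in_M_iff: "x \<in> M \<longleftrightarrow> (\<forall>k\<in>K. cinner x k = 0)"
  by (simp add: M_eq ortho_complement_def)

lemma P_in: "x \<in> M \<Longrightarrow> P x \<in> M"
  using P_K by (simp add: in_M_iff P_adj)

definition RP :: "'a set" where "RP = {x\<in>M. P x = x}"

lemma RP_eq: "RP = P ` M"
  using P_in by (force simp: RP_def)

lemma RP_D: "v \<in> RP \<Longrightarrow> v \<in> M" "v \<in> RP \<Longrightarrow> P v = v"
  by (auto simp: RP_def)

text \<open>The vectors fixed by \<open>P\<close> are those orthogonal to the range of
  \<open>1 - P\<close>, so \<open>RP\<close> is an orthogonal complement.\<close>

lemma closed_csubspace_RP: "closed_csubspace RP"
proof -
  have "(\<forall>x. cinner y (x - P x) = 0) \<longleftrightarrow> P y = y" for y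
  proof
    assume "\<forall>x. cinner y (x - P x) = 0"
    then have "cinner y ((y - P y) - P (y - P y)) = 0" by blast
    then have "cinner (y - P y) (y - P y) = 0"
      by (simp add: cinner_diff_left cinner_diff_right P_diff P_adj)
    then show "P y = y" by simp
  next
    assume "P y = y"
    then show "\<forall>x. cinner y (x - P x) = 0"
      using P_adj[of y] by (simp add: cinner_diff_right)
  qed
  then have "RP = ortho_complement (K \<union> range (\<lambda>x. x - P x))"
    unfolding RP_def ortho_complement_def set_eq_iff mem_Collect_eq ball_Un ball_simps in_M_iff
    by simp
  then show ?thesis by (simp add: closed_csubspace_ortho_complement)
qed

lemma closed_csubspace_NP: "closed_csubspace (nullspace_on M P)"
proof -
  have "(\<forall>x. cinner y (P x) = 0) \<longleftrightarrow> P y = 0" for y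
  proof
    assume "\<forall>x. cinner y (P x) = 0"
    then have "cinner (P y) (P y) = 0"
      using P_adj[of y "P y"] by simp
    then show "P y = 0" by simp
  next
    assume "P y = 0"
    then show "\<forall>x. cinner y (P x) = 0"
      using P_adj[of y] by simp
  qed
  then have "nullspace_on M P = ortho_complement (K \<union> range P)"
    unfolding nullspace_on_def[of M] ortho_complement_def set_eq_iff mem_Collect_eq ball_Un ball_simps in_M_iff
    by simp
  then show ?thesis by (simp add: closed_csubspace_ortho_complement)
qed

lemma norm_X_le:
  assumes "x \<in> M"
  shows "norm (X x) \<le> pi / 2 * norm x"
proof (cases "x = 0")
  case True
  then show ?thesis using bounded_op_zero[OF selfadjoint_opD(1)[OF X] M] by simp
next
  case False
  obtain C where C: "\<And>x. x \<in> M \<Longrightarrow> norm (X x) \<le> C * norm x"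
    using bounded_opD(5)[OF selfadjoint_opD(1)[OF X]] by blast
  \<comment> \<open>A real supremum bounds its members only if they are bounded above; at
    \<open>y = 0\<close> the quotient is 0 by convention.\<close>
  have "norm (X y) / norm y \<le> \<bar>C\<bar>" if "y \<in> M" for y
  proof (cases "y = 0")
    case False
    have "norm (X y) / norm y \<le> C"
      using C[OF that] False by (simp add: pos_divide_le_eq)
    then show ?thesis by simp
  qed simp
  then have "bdd_above ((\<lambda>x. norm (X x) / norm x) ` M)"
    by (intro bdd_aboveI2)
  then have "norm (X x) / norm x \<le> onorm_on M X"
    unfolding onorm_on_def by (rule cSUP_upper[OF assms])
  also have "\<dots> \<le> pi / 2"
    using exponent by (simp add: geodesic_exponent_def)
  finally show ?thesis using False by (simp add: pos_divide_le_eq)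
qed

text \<open>Codiagonality as one commutation rule, \<open>P X = X (1 - P)\<close>, obtained by
  splitting \<open>x\<close> along \<open>P\<close>.\<close>

lemma P_X:
  assumes x: "x \<in> M"
  shows "P (X x) = X x - X (P x)"
proof -
  have d: "x - P x \<in> M" using x P_in closed_csubspaceD(6)[OF M] by simp
  have co: "P (X (P x)) = 0" "X (x - P x) - P (X (x - P x)) = 0"
    using exponent x by (auto simp: geodesic_exponent_def codiagonal_def)
  have "P (X x) = P (X (P x)) + P (X (x - P x))"
    using X_add[OF P_in[OF x] d] by (simp flip: P_add)
  also have "\<dots> = X (x - P x)" using co by simp
  also have "\<dots> = X x - X (P x)" by (rule X_diff[OF x P_in[OF x]])
  finally show ?thesis .
qed

section \<open>The symmetry \<open>2 P - 1\<close> and its action on the flow\<close>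

definition S :: "'a \<Rightarrow> 'a" where "S x = P x + P x - x"

lemma S_RP: "v \<in> RP \<Longrightarrow> S v = v"
  by (simp add: S_def RP_def)

lemma S_in: "x \<in> M \<Longrightarrow> S x \<in> M"
  using P_in closed_csubspaceD(3,6)[OF M] by (simp add: S_def)

lemma S_X: "x \<in> M \<Longrightarrow> S (X x) = - X (S x)"
  using P_X X_diff[of "P x + P x" x] X_add[of "P x" "P x"] P_in closed_csubspaceD(3)[OF M]
  by (simp add: S_def)

lemma S_scaleC: "S (c *\<^sub>C x) = c *\<^sub>C S x"
  by (simp add: S_def P_scaleC scaleC_add_right scaleC_diff_right)

lemma bounded_linear_P: "bounded_linear P"
proof -
  obtain C where "\<And>x. norm (P x) \<le> C * norm x"
    using bounded_opD(5)[OF bounded_op_P] by blast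
  then show ?thesis
    by (intro bounded_linear_intro[where K = C])
      (auto simp: P_add P_scaleC scaleR_scaleC[of _ "_ :: 'a"] mult.commute)
qed

lemma bounded_linear_S: "bounded_linear S"
  unfolding S_def[abs_def]
  by (intro bounded_linear_sub bounded_linear_add bounded_linear_P bounded_linear_ident)

text \<open>Reversing time compensates the sign in \<open>S_X\<close>: both sides are flow lines of
  \<open>iX\<close> that start at \<open>S x\<close>.\<close>

lemma S_U:
  assumes x: "x \<in> M"
  shows "S (U (- t) x) = U t (S x)"
proof -
  have "flow M iX (\<lambda>t. S (U (- t) x))"
    unfolding flow_def
  proof (intro allI conjI)
    fix t
    show "S (U (- t) x) \<in> M" by (rule S_in[OF U_in[OF x]])
    have "(((\<lambda>t. U t x) \<circ> uminus) has_vector_derivative (- 1) *\<^sub>R iX (U (- t) x)) (at t)"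
      by (intro vector_diff_chain_at U_has_vector_derivative[OF x])
        (auto intro!: derivative_eq_intros)
    then have "((\<lambda>t. S (U (- t) x)) has_vector_derivative S (- iX (U (- t) x))) (at t)"
      by (intro bounded_linear.has_vector_derivative[OF bounded_linear_S]) (simp add: o_def)
    also have "S (- iX (U (- t) x)) = iX (S (U (- t) x))"
      using S_scaleC[of "- \<i>" "X (U (- t) x)"] S_X[OF U_in[OF x]] by simp
    finally show "((\<lambda>t. S (U (- t) x)) has_vector_derivative iX (S (U (- t) x))) (at t)" .
  qed
  then have "(\<lambda>t. S (U (- t) x)) t = (\<lambda>t. U t (S x)) t"
    by (rule flow_iX_unique[OF _ flow_U[OF S_in[OF x]]]) (simp add: x S_in[OF x])
  then show ?thesis .
qed

text \<open>
  \<open>P = (1 + S) / 2\<close> and \<open>Q = (1 + exp (2 \<i> X) S) / 2\<close>, so that \<open>P Q P = cos\<^sup>2 X P\<close> on \<open>M\<close>.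
\<close>

lemma PQ_RP:
  assumes v: "v \<in> RP"
  shows "4 *\<^sub>C P (Q v) = 2 *\<^sub>C v + (U 2 v + U (- 2) v)"
proof -
  have vM: "v \<in> M" and Pv: "P v = v" using v by (auto simp: RP_def)
  have PP: "P x + P x = x + S x" for x by (simp add: S_def)
  \<comment> \<open>In \<open>2 P = 1 + S\<close> the symmetry turns \<open>U (- 1) v\<close> into
    \<open>U 1 v\<close>, because it fixes \<open>v\<close>.\<close>
  have "P (U (- 1) v) + P (U (- 1) v) = U (- 1) v + U 1 v"
    using S_U[OF vM, of 1] S_RP[OF v] by (simp add: PP)
  then have "U 1 (P (U (- 1) v)) + U 1 (P (U (- 1) v)) = U 1 (U (- 1) v + U 1 v)"
    using U_add[OF P_in[OF U_in[OF vM]] P_in[OF U_in[OF vM]]] by metis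
  also have "\<dots> = v + U 2 v"
    using U_add[OF U_in[OF vM] U_in[OF vM]] by (simp add: U_U[OF vM] vM)
  also have "U 1 (P (U (- 1) v)) = Q v"
    using exponent vM by (simp add: geodesic_exponent_def U_def)
  finally have QQ: "Q v + Q v = v + U 2 v" .
  \<comment> \<open>The outer \<open>P\<close> is replaced by half of \<open>1 + S\<close> as well;
    \<open>S\<close> takes \<open>U 2 v\<close> to \<open>U (- 2) v\<close>.\<close>
  have "P (Q v) + P (Q v) = P (v + U 2 v)"
    by (metis QQ P_add)
  then have "(P (Q v) + P (Q v)) + (P (Q v) + P (Q v)) = P (v + U 2 v) + P (v + U 2 v)"
    by simp
  also have "\<dots> = (v + v) + (P (U 2 v) + P (U 2 v))"
    by (simp add: P_add Pv)
  also have "\<dots> = (v + v) + (U 2 v + U (- 2) v)"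
    using S_U[OF vM, of "- 2"] S_RP[OF v] by (simp only: PP) simp
  finally show ?thesis
    using scaleC_add_left[of 1 1 v] scaleC_add_left[of 1 1 "P (Q v)"]
      scaleC_add_left[of 2 2 "P (Q v)"] by simp
qed

section \<open>Passing eigenvectors between \<open>P Q\<close> and the square of
  \<open>X\<close>\<close>

lemma norm_Q_le: "norm (Q x) \<le> norm x"
proof -
  have "(norm (Q x))\<^sup>2 = inner (Q x) x"
    using Q_adj[of "Q x" x] by (simp add: power2_norm_eq_inner inner_eq_Re_cinner)
  also have "\<dots> \<le> norm (Q x) * norm x"
    by (rule norm_cauchy_schwarz)
  finally show ?thesis
    by (cases "Q x = 0") (simp_all add: power2_eq_square)
qed

text \<open>Pairing with \<open>v\<close> gives \<open>l = (cos a)^2\<close>, and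
  \<open>l \<noteq> 0\<close> keeps \<open>a\<close> below \<open>pi / 2\<close>. By
  \<open>PQ_RP\<close>, \<open>v\<close> is annihilated by a quadratic polynomial in
  \<open>U 2\<close> with roots \<open>cis (2 * a)\<close> and \<open>cis (- (2 * a))\<close>;
  \<open>eigenvector_X_of_U_2\<close> converts one factor after the other into a linear factor in
  \<open>X\<close>.\<close>

lemma eigenvector_X_squared_of_PQ:
  assumes v: "v \<in> RP" and ev: "P (Q v) = l *\<^sub>C v" and "l \<noteq> 0"
  shows "\<exists>c. X (X v) = c *\<^sub>C v"
proof (cases "v = 0")
  case True
  then show ?thesis using bounded_op_zero[OF selfadjoint_opD(1)[OF X] M] by simp
next
  case False
  have vM: "v \<in> M" and Pv: "P v = v" using v by (auto simp: RP_def)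
  define r where "r = norm (Q v) / norm v"
  have "l * cinner v v = cinner (P (Q v)) v" by (simp add: ev cinner_scaleC_left)
  also have "\<dots> = cinner (Q v) (Q v)"
    using P_adj[of "Q v" v] Q_adj[of "Q v" v] by (simp add: Pv)
  finally have l: "l = complex_of_real (r\<^sup>2)"
    using False by (simp add: cinner_self r_def power_divide field_simps)
  have r: "0 < r" "r \<le> 1"
    using False \<open>l \<noteq> 0\<close> norm_Q_le[of v] l by (auto simp: r_def)
  define a where "a = arccos r"
  have cos_a: "cos a = r" and a: "\<bar>a\<bar> < pi / 2"
  proof -
    show "cos a = r" using r by (simp add: a_def)
    have "0 \<le> a" using r by (auto simp: a_def intro: arccos_lbound)
    moreover have "a < pi / 2"
      using arccos_less_arccos[of 0 r] r by (simp add: a_def)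
    ultimately show "\<bar>a\<bar> < pi / 2" by simp
  qed
  \<comment> \<open>The sum of the two roots; their product is 1.\<close>
  define k where "k = complex_of_real (2 * cos (2 * a))"
  have k: "k = cis (2 * a) + cis (- (2 * a))" "4 * l - 2 = k"
    using cos_double_cos[of a] by (auto simp: k_def l cos_a complex_eq_iff)
  have "2 *\<^sub>C v + (U 2 v + U (- 2) v) = (4 * l) *\<^sub>C v"
    using PQ_RP[OF v] by (simp add: ev scaleC_scaleC)
  then have sum: "U 2 v + U (- 2) v = k *\<^sub>C v"
    by (simp flip: k(2) add: scaleC_diff_left eq_diff_eq add.commute)
  have "U 2 (U 2 v + U (- 2) v) = U 2 (k *\<^sub>C v)" by (simp add: sum)
  then have E4: "U 2 (U 2 v) = k *\<^sub>C U 2 v - v"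
    using U_add[OF U_in[OF vM] U_in[OF vM], of 2 2 "- 2"] U_scaleC[OF vM, of 2 k]
      U_U[OF vM, of 2 "- 2"] vM by (simp add: algebra_simps)
  \<comment> \<open>One factor of the quadratic applied to \<open>v\<close>; on the result
    \<open>U 2\<close> acts by the other root.\<close>
  define w where "w = U 2 v - cis (- (2 * a)) *\<^sub>C v"
  have wM: "w \<in> M"
    using vM U_in closed_csubspaceD(4,6)[OF M] by (simp add: w_def)
  have "U 2 w = k *\<^sub>C U 2 v - v - cis (- (2 * a)) *\<^sub>C U 2 v"
    using U_diff[OF U_in[OF vM] closed_csubspaceD(4)[OF M vM]] U_scaleC[OF vM] E4 by (simp add: w_def)
  also have "\<dots> = cis (2 * a) *\<^sub>C w"
    by (simp add: w_def k(1) scaleC_add_left scaleC_diff_right scaleC_scaleC cis_mult)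
  finally have "X w = complex_of_real a *\<^sub>C w"
    using eigenvector_X_of_U_2[OF wM _ a norm_X_le] by blast
  then have w_eq: "U 2 (X v) - cis (- (2 * a)) *\<^sub>C X v
      = complex_of_real a *\<^sub>C U 2 v - (complex_of_real a * cis (- (2 * a))) *\<^sub>C v"
    using X_diff[OF U_in[OF vM] closed_csubspaceD(4)[OF M vM]] X_scaleC[OF vM] X_U[OF vM]
    by (simp add: w_def scaleC_diff_right scaleC_scaleC)
  \<comment> \<open>As \<open>X\<close> commutes with \<open>U 2\<close>, \<open>w_eq\<close> says
    that \<open>U 2\<close> acts on \<open>u\<close> by \<open>cis (- (2 * a))\<close>, so the
    eigenvector lemma applies with \<open>- a\<close>.\<close>
  define u where "u = X v - complex_of_real a *\<^sub>C v"
  have uM: "u \<in> M"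
    using vM X_in closed_csubspaceD(4,6)[OF M] by (simp add: u_def)
  have "U 2 u = U 2 (X v) - complex_of_real a *\<^sub>C U 2 v"
    using U_diff[OF X_in[OF vM] closed_csubspaceD(4)[OF M vM]] U_scaleC[OF vM] by (simp add: u_def)
  also have "\<dots> = cis (- (2 * a)) *\<^sub>C X v - (complex_of_real a * cis (- (2 * a))) *\<^sub>C v"
    using w_eq by (simp add: algebra_simps)
  also have "\<dots> = cis (2 * - a) *\<^sub>C u"
    by (simp add: u_def scaleC_diff_right scaleC_scaleC mult.commute)
  finally have "X u = complex_of_real (- a) *\<^sub>C u"
    using eigenvector_X_of_U_2[OF uM, of "- a"] a norm_X_le by simp
  then have "X (X v) = (complex_of_real a * complex_of_real a) *\<^sub>C v"
    using X_diff[OF X_in[OF vM] closed_csubspaceD(4)[OF M vM]] X_scaleC[OF vM]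
    by (simp add: u_def scaleC_diff_right scaleC_scaleC)
  then show ?thesis by blast
qed

text \<open>Here \<open>c\<close> is the square of \<open>a = norm (X v) / norm v\<close>, and
  \<open>(X - a) (X + a) v = 0\<close> splits \<open>v\<close> when \<open>a \<noteq> 0\<close>; if
  \<open>X v = 0\<close>, then \<open>v\<close> and 0 serve. The last conclusion carries
  orthogonality to \<open>u\<close> and \<open>u'\<close> over to \<open>X v\<close>.\<close>

lemma X_squared_eigenvector:
  assumes v: "v \<in> M" and ev: "X (X v) = c *\<^sub>C v"
  obtains a :: real and u u' where
    "u \<in> M" "X u = complex_of_real a *\<^sub>C u" "u' \<in> M" "X u' = complex_of_real (- a) *\<^sub>C u'"
    "v = u + u'" "\<exists>d d'. X v = d *\<^sub>C u + d' *\<^sub>C u'"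
proof (cases "X v = 0")
  case True
  have "(0 :: 'a) \<in> M" "X 0 = 0"
    using closed_csubspaceD(2)[OF M] bounded_op_zero[OF selfadjoint_opD(1)[OF X] M] by auto
  moreover have "X v = 0 *\<^sub>C v + 0 *\<^sub>C 0" using True by simp
  ultimately show ?thesis
    using that[of v 0 0] v True by auto
next
  case False
  then have "v \<noteq> 0" using bounded_op_zero[OF selfadjoint_opD(1)[OF X] M] by auto
  define a where "a = norm (X v) / norm v"
  have "c * cinner v v = cinner (X (X v)) v" by (simp add: ev cinner_scaleC_left)
  also have "\<dots> = cinner (X v) (X v)" by (rule X_adj[OF X_in[OF v] v])
  finally have c: "c = complex_of_real a * complex_of_real a"
    using \<open>v \<noteq> 0\<close> by (simp add: cinner_self a_def power2_eq_square field_simps)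
  have a: "a \<noteq> 0" using False \<open>v \<noteq> 0\<close> by (simp add: a_def)
  let ?h = "complex_of_real (1 / (2 * a))"
  define u where "u = ?h *\<^sub>C (complex_of_real a *\<^sub>C v + X v)"
  define u' where "u' = ?h *\<^sub>C (complex_of_real a *\<^sub>C v - X v)"
  have in_M: "complex_of_real a *\<^sub>C v \<in> M" "X v \<in> M"
    "complex_of_real a *\<^sub>C v + X v \<in> M" "complex_of_real a *\<^sub>C v - X v \<in> M"
    using v X_in closed_csubspaceD(3,4,6)[OF M] by auto
  have uM: "u \<in> M" "u' \<in> M"
    using in_M closed_csubspaceD(4)[OF M] by (auto simp: u_def u'_def)
  have "X (complex_of_real a *\<^sub>C v + X v) = complex_of_real a *\<^sub>C (complex_of_real a *\<^sub>C v + X v)"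
    using X_add[OF in_M(1,2)] X_scaleC[OF v] by (simp add: ev c scaleC_add_right scaleC_scaleC)
  then have Xu: "X u = complex_of_real a *\<^sub>C u"
    using X_scaleC[OF in_M(3)] by (simp add: u_def scaleC_scaleC mult.commute)
  have "X (complex_of_real a *\<^sub>C v - X v) = complex_of_real (- a) *\<^sub>C (complex_of_real a *\<^sub>C v - X v)"
    using X_diff[OF in_M(1,2)] X_scaleC[OF v] by (simp add: ev c scaleC_diff_right scaleC_scaleC)
  then have Xu': "X u' = complex_of_real (- a) *\<^sub>C u'"
    using X_scaleC[OF in_M(4)] by (simp add: u'_def scaleC_scaleC mult.commute)
  have "u + u' = (?h * complex_of_real a) *\<^sub>C v + (?h * complex_of_real a) *\<^sub>C v"
    by (simp only: u_def u'_def scaleC_add_right scaleC_diff_right scaleC_scaleC) simp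
  also have "\<dots> = (?h * complex_of_real a + ?h * complex_of_real a) *\<^sub>C v"
    by (simp only: scaleC_add_left)
  also have "?h * complex_of_real a + ?h * complex_of_real a = 1"
    using a by (simp add: field_simps)
  finally have "v = u + u'" by simp
  moreover from this have "X v = complex_of_real a *\<^sub>C u + complex_of_real (- a) *\<^sub>C u'"
    using X_add[OF uM] Xu Xu' by simp
  ultimately show ?thesis
    using that[OF uM(1) Xu uM(2) Xu'] by blast
qed

text \<open>\<open>U 2 + U (- 2)\<close> acts on \<open>u\<close> and \<open>u'\<close> by the same
  scalar, \<open>cis (2 * a) + cis (- (2 * a))\<close> being even in \<open>a\<close>.\<close>

lemma eigenvector_PQ_of_X_squared:
  assumes v: "v \<in> RP" and ev: "X (X v) = c *\<^sub>C v"
  shows "\<exists>l. P (Q v) = l *\<^sub>C v"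
proof -
  have vM: "v \<in> M" using v by (simp add: RP_def)
  from X_squared_eigenvector[OF vM ev] obtain a u u' where
    u: "u \<in> M" "X u = complex_of_real a *\<^sub>C u" and u': "u' \<in> M" "X u' = complex_of_real (- a) *\<^sub>C u'"
    and v_eq: "v = u + u'" by metis
  let ?k = "cis (2 * a) + cis (- (2 * a))"
  have "U 2 v + U (- 2) v = ?k *\<^sub>C v"
    using U_add[OF u(1) u'(1)] U_eigenvector[OF u] U_eigenvector[OF u']
    by (simp add: v_eq scaleC_add_right scaleC_add_left)
  then have "4 *\<^sub>C P (Q v) = (2 + ?k) *\<^sub>C v"
    using PQ_RP[OF v] by (simp add: scaleC_add_left)
  then have "(1 / 4) *\<^sub>C 4 *\<^sub>C P (Q v) = (1 / 4) *\<^sub>C (2 + ?k) *\<^sub>C v" by simp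
  then have "P (Q v) = (1 / 4 * (2 + ?k)) *\<^sub>C v"
    by (simp only: scaleC_scaleC) simp
  then show ?thesis by blast
qed

text \<open>If \<open>x\<close> is orthogonal to all eigenvectors of \<open>X\<close>, it is
  orthogonal to \<open>v\<close> and \<open>X v\<close> for each eigenvector \<open>v\<close> of the
  square in \<open>RP\<close>. Then \<open>P x\<close> and \<open>P (X x)\<close> vanish, and
  \<open>P_X\<close> gives \<open>X x = 0\<close>. Conversely, the square commutes with
  \<open>P\<close>, so \<open>P e\<close> is an eigenvector of it whenever \<open>e\<close> is one
  of \<open>X\<close>.\<close>

lemma eigenvectors_total_X_iff:
  "eigenvectors_total RP (\<lambda>y. X (X y)) \<longleftrightarrow> eigenvectors_total M X"
proof
  assume tot: "eigenvectors_total RP (\<lambda>y. X (X y))"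
  show "eigenvectors_total M X"
  proof (rule eigenvectors_totalI)
    fix x assume x: "x \<in> M" and orth: "\<And>e. e \<in> eigenvectors M X \<Longrightarrow> cinner x e = 0"
    have *: "cinner x v = 0" "cinner x (X v) = 0" if v: "v \<in> eigenvectors RP (\<lambda>y. X (X y))" for v
    proof -
      obtain c where vM: "v \<in> M" and c: "X (X v) = c *\<^sub>C v"
        using v by (auto simp: eigenvectors_def RP_def)
      from X_squared_eigenvector[OF vM c] obtain a u u' d d' where
        u: "u \<in> M" "X u = complex_of_real a *\<^sub>C u" and u': "u' \<in> M" "X u' = complex_of_real (- a) *\<^sub>C u'"
        and v_eq: "v = u + u'" and Xv: "X v = d *\<^sub>C u + d' *\<^sub>C u'" by metis
      have "u \<in> eigenvectors M X" "u' \<in> eigenvectors M X"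
        using u u' unfolding eigenvectors_def by blast+
      then have "cinner x u = 0" "cinner x u' = 0" using orth by auto
      then show "cinner x v = 0" "cinner x (X v) = 0"
        by (simp_all add: v_eq[symmetric] Xv cinner_add_right cinner_scaleC_right)
          (simp add: v_eq cinner_add_right)
    qed
    have "P y = 0" if y: "y \<in> M" and "\<And>v. v \<in> eigenvectors RP (\<lambda>y. X (X y)) \<Longrightarrow> cinner y v = 0" for y
    proof (rule eigenvectors_totalD[OF tot])
      show "P y \<in> RP" using P_in[OF y] by (simp add: RP_def)
      show "cinner (P y) e = 0" if "e \<in> eigenvectors RP (\<lambda>y. X (X y))" for e
        using that \<open>\<And>v. v \<in> eigenvectors RP (\<lambda>y. X (X y)) \<Longrightarrow> cinner y v = 0\<close>[OF that]
        by (simp add: P_adj eigenvectors_def RP_def)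
    qed
    note P0 = this
    have "P x = 0" by (rule P0[OF x *(1)])
    moreover have "P (X x) = 0"
    proof (rule P0[OF X_in[OF x]])
      fix v assume v: "v \<in> eigenvectors RP (\<lambda>y. X (X y))"
      then have "v \<in> M" by (simp add: eigenvectors_def RP_def)
      then show "cinner (X x) v = 0" using X_adj[OF x] *(2)[OF v] by simp
    qed
    ultimately have "X x = 0 *\<^sub>C x"
      using P_X[OF x] bounded_op_zero[OF selfadjoint_opD(1)[OF X] M] by simp
    then show "x \<in> eigenvectors M X"
      using x unfolding eigenvectors_def by blast
  qed
next
  assume tot: "eigenvectors_total M X"
  show "eigenvectors_total RP (\<lambda>y. X (X y))"
    unfolding eigenvectors_total_def
  proof (intro ballI impI)
    fix y assume y: "y \<in> RP" and orth: "\<forall>e\<in>eigenvectors RP (\<lambda>y. X (X y)). cinner y e = 0"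
    show "y = 0"
    proof (rule eigenvectors_totalD[OF tot])
      show "y \<in> M" using y by (simp add: RP_def)
      fix e assume "e \<in> eigenvectors M X"
      then obtain c where e: "e \<in> M" "X e = c *\<^sub>C e" by (auto simp: eigenvectors_def)
      have XP: "X (P z) = X z - P (X z)" if "z \<in> M" for z
        using P_X[OF that] by simp
      have "X (X (P e)) = P (X (X e))"
        using XP[OF e(1)] XP[OF X_in[OF e(1)]] X_diff[OF X_in[OF e(1)] P_in[OF X_in[OF e(1)]]] by simp
      also have "\<dots> = (c * c) *\<^sub>C P e"
        using X_scaleC[OF e(1)] by (simp add: e(2) P_scaleC scaleC_scaleC)
      finally have "P e \<in> eigenvectors RP (\<lambda>y. X (X y))"
        using P_in[OF e(1)] by (auto simp: eigenvectors_def RP_def)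
      then have "cinner y (P e) = 0" using orth by blast
      then show "cinner y e = 0"
        using P_adj[of y e] y by (simp add: RP_def)
    qed
  qed
qed

text \<open>The operator is \<open>T T'\<close> for \<open>T = P Q\<close>, hence the double
  \<open>Q\<close>. Its eigenvectors for nonzero eigenvalues lie in \<open>RP\<close>, where they
  are compared with those of the square of \<open>X\<close>; for eigenvalue 0, \<open>P e\<close>
  lies in \<open>K\<close>, orthogonal to \<open>M\<close>.\<close>

lemma eigenvectors_total_PQP_iff:
  "eigenvectors_total UNIV (\<lambda>x. P (Q (Q (P x)))) \<longleftrightarrow> eigenvectors_total RP (\<lambda>y. X (X y))"
proof
  assume tot: "eigenvectors_total UNIV (\<lambda>x. P (Q (Q (P x))))"
  show "eigenvectors_total RP (\<lambda>y. X (X y))"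
    unfolding eigenvectors_total_def
  proof (intro ballI impI)
    fix y assume y: "y \<in> RP" and orth: "\<forall>e\<in>eigenvectors RP (\<lambda>y. X (X y)). cinner y e = 0"
    show "y = 0"
    proof (rule eigenvectors_totalD[OF tot])
      fix e assume "e \<in> eigenvectors UNIV (\<lambda>x. P (Q (Q (P x))))"
      then obtain l where l: "P (Q (P e)) = l *\<^sub>C e" by (auto simp: eigenvectors_def)
      show "cinner y e = 0"
      proof (cases "l = 0")
        case True
        have "cinner (Q (P e)) (Q (P e)) = cinner (P (Q (P e))) e"
          using Q_adj[of "Q (P e)" "P e"] P_adj[of "Q (P e)" e] by simp
        then have "Q (P e) = 0" using l True by simp
        then have "P e \<in> K" by (simp add: nullspace_on_def)
        then have "cinner y (P e) = 0" using y in_M_iff RP_D(1) by blast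
        then show ?thesis using P_adj[of y e] RP_D(2)[OF y] by simp
      next
        case False
        \<comment> \<open>Dividing by \<open>l\<close> exhibits \<open>e\<close> in the range of
          \<open>P\<close>, and below orthogonal to \<open>K\<close>.\<close>
        have e: "e = P ((1 / l) *\<^sub>C Q (P e))"
          using False by (simp add: P_scaleC l scaleC_scaleC)
        then have Pe: "P e = e" by (metis P_idem)
        have "cinner (P (Q (P e))) k = 0" if "k \<in> K" for k
          using QP_K[OF that] by (simp add: P_adj Q_adj)
        then have "e \<in> M"
          using False by (simp add: in_M_iff l cinner_scaleC_left)
        then have eR: "e \<in> RP" using Pe by (simp add: RP_def)
        have "P (Q e) = l *\<^sub>C e" using l by (simp add: Pe)
        then have "e \<in> eigenvectors RP (\<lambda>y. X (X y))"
          using eigenvector_X_squared_of_PQ[OF eR _ False] eR by (simp add: eigenvectors_def)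
        then show ?thesis using orth by blast
      qed
    qed simp
  qed
next
  assume tot: "eigenvectors_total RP (\<lambda>y. X (X y))"
  show "eigenvectors_total UNIV (\<lambda>x. P (Q (Q (P x))))"
  proof (rule eigenvectors_totalI)
    fix x assume orth: "\<And>e. e \<in> eigenvectors UNIV (\<lambda>x. P (Q (Q (P x)))) \<Longrightarrow> cinner x e = 0"
    \<comment> \<open>\<open>K\<close> consists of eigenvectors for 0, so orthogonality to them puts
      \<open>x\<close> into \<open>M\<close>.\<close>
    have "k \<in> eigenvectors UNIV (\<lambda>x. P (Q (Q (P x))))" if "k \<in> K" for k
      using QP_K[OF that] by (auto simp: eigenvectors_def intro: exI[of _ 0])
    then have x: "x \<in> M" using orth by (simp add: in_M_iff)
    have "P x = 0"
    proof (rule eigenvectors_totalD[OF tot])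
      show "P x \<in> RP" using P_in[OF x] by (simp add: RP_def)
      fix v assume "v \<in> eigenvectors RP (\<lambda>y. X (X y))"
      then obtain c where v: "v \<in> RP" "X (X v) = c *\<^sub>C v" by (auto simp: eigenvectors_def)
      from eigenvector_PQ_of_X_squared[OF v] RP_D(2)[OF v(1)]
      have "v \<in> eigenvectors UNIV (\<lambda>x. P (Q (Q (P x))))" by (simp add: eigenvectors_def)
      then show "cinner (P x) v = 0"
        using orth P_adj[of x v] RP_D(2)[OF v(1)] by simp
    qed
    then show "x \<in> eigenvectors UNIV (\<lambda>x. P (Q (Q (P x))))"
      by (auto simp: eigenvectors_def intro: exI[of _ 0])
  qed
qed

lemma adjoint_pair_PQ: "adjoint_pair UNIV UNIV (\<lambda>x. P (Q x)) (\<lambda>x. Q (P x))"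
  using bounded_op_compose[OF bounded_op_P bounded_op_Q] bounded_op_compose[OF bounded_op_Q bounded_op_P]
  by (simp add: adjoint_pair_def P_adj Q_adj)

end

theorem theorem6p7:
  fixes P Q X Z Zstar :: "'a::complex_hilbert \<Rightarrow> 'a"
    and H' NP' RP' :: "'a set"
  assumes P: "orthogonal_projection UNIV P"
    and Q: "orthogonal_projection UNIV Q"
    and H': "H' = ortho_complement (nullspace_on UNIV (\<lambda>x. P x + Q x - x))"
    and NP': "NP' = nullspace_on H' P"
    and RP': "RP' = P ` H'"
    and X: "geodesic_exponent H' P Q X"
    and Z: "adjoint_pair NP' RP' Z Zstar"
    and matrix: "\<forall>x\<in>RP'. \<forall>y\<in>NP'. X (x + y) = Z y + Zstar x"
  shows "(S_decomposable UNIV UNIV (\<lambda>x. P (Q x)) \<longleftrightarrow> S_decomposable NP' RP' Z) \<and>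
         (S_decomposable NP' RP' Z \<longleftrightarrow> diagonalizable H' X)"
proof -
  interpret geodesic H' X P Q
    using P Q H' X closed_csubspace_ortho_complement
    by unfold_locales (auto simp: geodesic_exponent_def)
  have RP: "RP' = RP" by (simp add: RP' RP_eq)
  have NP: "closed_csubspace NP'" by (simp add: NP' closed_csubspace_NP)
  have bZ: "bounded_op NP' RP' Z" and bZ': "bounded_op RP' NP' Zstar"
    using Z by (auto simp: adjoint_pair_def)
  \<comment> \<open>The matrix takes \<open>y\<close> in \<open>RP\<close> to
    \<open>Zstar y\<close>, which lies in the kernel of \<open>P\<close> and is taken on to
    \<open>Z (Zstar y)\<close>.\<close>
  have "Z (Zstar y) = X (X y)" if y: "y \<in> RP" for y
  proof -
    have "0 \<in> RP'" "0 \<in> NP'" "Zstar y \<in> NP'"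
      using closed_csubspaceD(2)[OF NP] closed_csubspaceD(2)[OF closed_csubspace_RP]
        bounded_opD(1)[OF bZ'] y by (auto simp: RP)
    moreover have "Z 0 = 0" "Zstar 0 = 0"
      using bounded_op_zero[OF bZ NP] bounded_op_zero[OF bZ'] closed_csubspace_RP by (auto simp: RP)
    ultimately have "X (y + 0) = Zstar y" "X (0 + Zstar y) = Z (Zstar y)"
      using matrix y by (simp_all only: RP) simp_all
    then show ?thesis by simp
  qed
  then have "eigenvectors RP (\<lambda>y. Z (Zstar y)) = eigenvectors RP (\<lambda>y. X (X y))"
    by (auto simp: eigenvectors_def)
  then have "eigenvectors_total RP' (\<lambda>y. Z (Zstar y)) \<longleftrightarrow> eigenvectors_total RP (\<lambda>y. X (X y))"
    by (simp add: eigenvectors_total_def RP)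
  \<comment> \<open>The three properties are totality for \<open>P Q P\<close>, for
    \<open>Z Zstar\<close> and for \<open>X\<close>; each amounts to totality for the square of
    \<open>X\<close> on \<open>RP\<close>.\<close>
  then show ?thesis
    using S_decomposable_iff_eigenvectors_total[OF adjoint_pair_PQ]
      S_decomposable_iff_eigenvectors_total[OF Z NP] closed_csubspace_RP
      diagonalizable_iff_eigenvectors_total[OF bounded_selfadjoint.X[OF bounded_selfadjoint_axioms] M]
      eigenvectors_total_X_iff eigenvectors_total_PQP_iff
    by (simp add: RP)
qed

end
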